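(* Let $k$ be a positive integer and let $\sigma,\gamma,\rho,\delta$ be real numbers satisfying one of the following three alternatives: (1) $\sigma \geq \frac{\sqrt{2}+1}{\sqrt{3}}$, $\gamma =\frac{1}{3\sigma}$, $\rho=1$ and $\delta=2+\sigma+\frac{1}{3\sigma}$; (2) $\sigma = \frac{1}{3}\sqrt{\frac{5}{2}}$, $\gamma =\frac{\sqrt{10}}{3}$, $\rho=2$ and $\delta = 2+\frac{11}{3}\sqrt{\frac{1}{10}}$; (3) $\sigma = 0.2$, $\gamma=1.2$, $\rho=3$ and $\delta = 3.109$. Let $G$ be a $\sigma$-separable ²graph with $g = \bar{v}(G)-1 \geq \gamma$. Then there exists a real number $r(G) \geq \rho$ such that for every spanning sub²graph $G'$ of $G$ and every family $G_1,\dots,G_l$ ($l\ge 0$) of disjoint anticliques of $G'$, we have $$\bar{e}(G')~\leq~\delta\, g + \frac{1}{r(G)}\left(\frac{2}{3}-\sum_{i=1}^l \bar{v}(G_i)^2\right).$$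
   Context: Fix a positive integer $k$. A ²graph is a pair $G=(V(G),E(G))$ with $V(G)$ a finite set and $E(G)\subseteq V(G)\times V(G)$ (ordered pairs, loops $(v,v)$ allowed). Write $v(G)=|V(G)|$, $e(G)=|E(G)|$, and normalize $\bar{v}(G)=v(G)/k$, $\bar{e}(G)=e(G)/k^2$. A sub²graph $C$ of $G$ is a ²graph with $V(C)\subseteq V(G)$ and $E(C)\subseteq E(G)$; it is spanning if $V(C)=V(G)$ and induced if $E(C)=E(G)\cap (V(C)\times V(C))$. A separation of a ²graph $G$ is a pair $(A,B)$ of induced, non-spanning sub²graphs of $G$ with $V(A)\cup V(B)=V(G)$, $E(A)\cup E(B)=E(G)$ and $|V(A)\cap V(B)|=k$. A ²graph $G$ is $\sigma$-separable if every sub²graph $C$ of $G$ with $\bar{v}(C)>1+\sigma$ has a separation. An anticlique of a ²graph $H$ is an induced sub²graph of $H$ with empty edge set; anticliques $G_1,\dots,G_l$ are disjoint if their vertex sets are pairwise disjoint. *)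

theory Defs
  imports Complex_Main "HOL-Library.Disjoint_Sets" "Graph_Theory.Digraph_Component" "Graph_Theory.Pair_Digraph"
begin

text \<open>
  A finite directed graph without parallel arcs in which loops are allowed is a
  \<^locale>\<open>pair_fin_digraph\<close>. The functions \<^const>\<open>subgraph\<close>, \<^const>\<open>induced_subgraph\<close> and
  \<^const>\<open>spanning\<close> expect a \<^typ>\<open>('a, 'a \<times> 'a) pre_digraph\<close>; \<^const>\<open>with_proj\<close>
  supplies the projections as tail and head maps. Note the argument order: in
  \<^term>\<open>subgraph C G\<close>, \<open>C\<close> is the subgraph of \<open>G\<close>.
\<close>

definition nverts :: "nat \<Rightarrow> 'a pair_pre_digraph \<Rightarrow> real" where
  "nverts k G = real (card (pverts G)) / real k"

definition narcs :: "nat \<Rightarrow> 'a pair_pre_digraph \<Rightarrow> real" where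
  "narcs k G = real (card (parcs G)) / (real k)\<^sup>2"

definition graph_separation ::
  "nat \<Rightarrow> 'a pair_pre_digraph \<Rightarrow> 'a pair_pre_digraph \<Rightarrow> 'a pair_pre_digraph \<Rightarrow> bool" where
  "graph_separation k G A B \<longleftrightarrow>
     induced_subgraph (with_proj A) (with_proj G) \<and> \<not> spanning (with_proj A) (with_proj G) \<and>
     induced_subgraph (with_proj B) (with_proj G) \<and> \<not> spanning (with_proj B) (with_proj G) \<and>
     pverts A \<union> pverts B = pverts G \<and>
     parcs A \<union> parcs B = parcs G \<and>
     card (pverts A \<inter> pverts B) = k"

definition separable :: "nat \<Rightarrow> real \<Rightarrow> 'a pair_pre_digraph \<Rightarrow> bool" where
  "separable k \<sigma> G \<longleftrightarrow>
     (\<forall>C :: 'a pair_pre_digraph. subgraph (with_proj C) (with_proj G) \<and> nverts k C > 1 + \<sigma> \<longrightarrow>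
        (\<exists>A B. graph_separation k C A B))"

definition anticlique :: "'a pair_pre_digraph \<Rightarrow> 'a pair_pre_digraph \<Rightarrow> bool" where
  "anticlique A H \<longleftrightarrow> induced_subgraph (with_proj A) (with_proj H) \<and> parcs A = {}"

end

(* Write g = v - 1 for the normalised size of a vertex set, so that g adds up when a set is
separated into two parts A and B. In every bound e <= 2 g + c - S / r, with S the sum of the
squares of the sizes of disjoint anticliques, the pair (r, c) behaves additively: the arcs inside
the separator are counted on the side of A only, so the separator is an anticlique on the side of B,
and Cauchy-Schwarz merges the two quadratic terms. A part of size b counted as a complete graph
contributes (s, b^2 / s) for any s in (0, 1], hence repeated separation gives c = 1 + sum of b^2 / s
and r = sum of s. The claim asks for c <= (delta - 2) g + 2 / (3 r). Once this holds for both parts it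
holds for the union, so the work lies in the first time that g passes gamma, and in attaching a part
with g < gamma to one that already satisfies the claim. *)

theory Submission
  imports Defs
begin

section \<open>Arc bounds and separations\<close>

text \<open>The constant \<open>2 / 3\<close> is what makes the claim survive a merge. The separator
  has size 1, so as an anticlique on the side of weight \<open>s\<close> it saves
  \<open>1 / s\<close>, and for \<open>r = s\<close> the inequality
  \<open>t / r + t / s - 1 / s \<le> t / (r + s)\<close> says exactly \<open>t \<le> 2 / 3\<close>.
  The obstacle is the summand 1 of c: it has to be paid once, and for g near 0 a complete graph
  violates the claim. How hard this is depends on the separations that occur before g reaches
  \<gamma>. In alternative (1) none is needed, because two parts below \<gamma> add up to less than
  \<sigma>. In (2), where \<gamma> is twice \<sigma>, all but a bounded number of parts are so small
  that a cost linear in their size is good enough. In (3), where \<gamma> is six times \<sigma>,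
  parts of many sizes can pile up, and their total cost is controlled by a potential with a
  logarithmic term.\<close>

definition excess :: "nat \<Rightarrow> 'a set \<Rightarrow> real" where
  "excess k W = real (card W) / real k - 1"

text \<open>
  Bounds the arcs of all subgraphs of the part of \<open>E\<close> on \<open>W\<close> that use no arc of \<open>N\<close>, for families
  of anticliques that avoid \<open>X\<close>. In a separation, the second part is used with the separator as
  \<open>X\<close> and all pairs of the separator as \<open>N\<close>.
\<close>

definition arc_bound ::
  "nat \<Rightarrow> ('a \<times> 'a) set \<Rightarrow> 'a set \<Rightarrow> 'a set \<Rightarrow> ('a \<times> 'a) set \<Rightarrow> real \<Rightarrow> real \<Rightarrow> bool" where
  "arc_bound k E W X N r c \<longleftrightarrow>
     (\<forall>F (I :: nat set) Z.
        F \<subseteq> E \<inter> (W \<times> W) - N \<and> finite I \<and> disjoint_family_on Z I \<and>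
        (\<forall>i\<in>I. Z i \<subseteq> W - X \<and> F \<inter> (Z i \<times> Z i) = {}) \<longrightarrow>
        real (card F) / (real k)\<^sup>2 \<le> 2 * excess k W + c - (\<Sum>i\<in>I. (real (card (Z i)) / real k)\<^sup>2) / r)"

lemma arc_boundI:
  assumes "\<And>F (I :: nat set) Z. F \<subseteq> E \<inter> (W \<times> W) - N \<Longrightarrow> finite I \<Longrightarrow> disjoint_family_on Z I \<Longrightarrow>
      (\<And>i. i \<in> I \<Longrightarrow> Z i \<subseteq> W - X) \<Longrightarrow> (\<And>i. i \<in> I \<Longrightarrow> F \<inter> (Z i \<times> Z i) = {}) \<Longrightarrow>
      real (card F) / (real k)\<^sup>2 \<le> 2 * excess k W + c - (\<Sum>i\<in>I. (real (card (Z i)) / real k)\<^sup>2) / r"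
  shows "arc_bound k E W X N r c"
  unfolding arc_bound_def by (intro allI impI, elim conjE, rule assms) simp_all

lemma arc_boundD:
  assumes "arc_bound k E W X N r c" "F \<subseteq> E \<inter> (W \<times> W) - N" "finite (I :: nat set)"
    "disjoint_family_on Z I" "\<And>i. i \<in> I \<Longrightarrow> Z i \<subseteq> W - X" "\<And>i. i \<in> I \<Longrightarrow> F \<inter> (Z i \<times> Z i) = {}"
  shows "real (card F) / (real k)\<^sup>2 \<le> 2 * excess k W + c - (\<Sum>i\<in>I. (real (card (Z i)) / real k)\<^sup>2) / r"
  using assms(1)[unfolded arc_bound_def, rule_format, of F I Z] assms(2-) by simp

lemma arc_bound_mono:
  assumes b: "arc_bound k E W X N r c" and r: "0 < r" "r \<le> r'" and c: "c \<le> c'"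
  shows "arc_bound k E W X N r' c'"
proof (rule arc_boundI)
  fix F and I :: "nat set" and Z
  assume *: "F \<subseteq> E \<inter> (W \<times> W) - N" "finite I" "disjoint_family_on Z I"
    "\<And>i. i \<in> I \<Longrightarrow> Z i \<subseteq> W - X" "\<And>i. i \<in> I \<Longrightarrow> F \<inter> (Z i \<times> Z i) = {}"
  have "(\<Sum>i\<in>I. (real (card (Z i)) / real k)\<^sup>2) / r' \<le> (\<Sum>i\<in>I. (real (card (Z i)) / real k)\<^sup>2) / r"
    using r by (intro divide_left_mono sum_nonneg mult_pos_pos) auto
  with arc_boundD[OF b *] c
  show "real (card F) / (real k)\<^sup>2 \<le> 2 * excess k W + c' - (\<Sum>i\<in>I. (real (card (Z i)) / real k)\<^sup>2) / r'"
    by linarith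
qed

lemma sum_squares_le_square_sum:
  fixes f :: "'b \<Rightarrow> real"
  assumes "finite I" "\<And>i. i \<in> I \<Longrightarrow> 0 \<le> f i"
  shows "(\<Sum>i\<in>I. (f i)\<^sup>2) \<le> (\<Sum>i\<in>I. f i)\<^sup>2"
  using assms
proof (induction I rule: finite_induct)
  case (insert i I)
  have "0 \<le> f i * (\<Sum>i\<in>I. f i)"
    using insert.prems by (intro mult_nonneg_nonneg sum_nonneg) auto
  with insert show ?case by (simp add: power2_eq_square algebra_simps)
qed simp

text \<open>The arcs of \<open>F\<close>, the pairs of \<open>N\<close> and the pairs inside the
  anticliques are disjoint subsets of \<open>W \<times> W\<close>, which is the case
  \<open>s = 1\<close>. The anticliques have total size at most that of \<open>W - X\<close>, so the
  sum of their squares is at most its square; this pays for replacing the weight 1 by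
  \<open>s\<close>.\<close>

lemma arc_bound_leaf:
  assumes k: "k > 0" and W: "finite W" and X: "X \<subseteq> W" and N: "N \<subseteq> X \<times> X" and s: "0 < s" "s \<le> 1"
  shows "arc_bound k E W X N s
    (1 + (excess k W)\<^sup>2 - real (card N) / (real k)\<^sup>2
       + ((real (card W) - real (card X)) / real k)\<^sup>2 * (1 / s - 1))"
proof (rule arc_boundI)
  fix F and I :: "nat set" and Z
  assume F: "F \<subseteq> E \<inter> (W \<times> W) - N" and I: "finite I" and Z: "disjoint_family_on Z I"
    "\<And>i. i \<in> I \<Longrightarrow> Z i \<subseteq> W - X" "\<And>i. i \<in> I \<Longrightarrow> F \<inter> (Z i \<times> Z i) = {}"
  define U where "U = (\<Union>i\<in>I. Z i \<times> Z i)"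
  have finX: "finite X" and finN: "finite N" and finF: "finite F"
    using finite_subset[OF X W] finite_subset[OF N] finite_subset[of F "W \<times> W"] F W by auto
  have finZ: "\<And>i. i \<in> I \<Longrightarrow> finite (Z i)" using Z(2) W by (meson Diff_subset finite_subset)
  have finU: "finite U" unfolding U_def using I finZ by auto
  have cU: "card U = (\<Sum>i\<in>I. card (Z i) * card (Z i))"
    unfolding U_def using I finZ Z(1)
    by (subst card_UN_disjoint) (auto simp: disjoint_family_on_def card_cartesian_product)
  have d: "F \<inter> N = {}" "(F \<union> N) \<inter> U = {}"
    using F N Z(2,3) unfolding U_def by blast+
  have "card F + card N + card U = card (F \<union> N \<union> U)"
    using d finF finN finU by (simp add: card_Un_disjoint)
  also have "\<dots> \<le> card (W \<times> W)"
  proof (rule card_mono)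
    show "F \<union> N \<union> U \<subseteq> W \<times> W"
      using F N X Z(2) unfolding U_def by fast
  qed (use W in auto)
  finally have c1: "card F + card N + card U \<le> card W * card W"
    by (simp add: card_cartesian_product)
  define Q where "Q = (\<Sum>i\<in>I. (real (card (Z i)) / real k)\<^sup>2)"
  have Q: "Q = real (card U) / (real k)\<^sup>2"
    unfolding Q_def cU by (simp add: sum_divide_distrib power2_eq_square)
  have "(\<Sum>i\<in>I. card (Z i)) = card (\<Union>i\<in>I. Z i)"
    using I finZ Z(1) by (subst card_UN_disjoint) (auto simp: disjoint_family_on_def)
  also have "\<dots> \<le> card (W - X)"
    using Z(2) W by (intro card_mono) auto
  also have "\<dots> = card W - card X" using X finX by (simp add: card_Diff_subset)
  finally have "real (\<Sum>i\<in>I. card (Z i)) \<le> real (card W) - real (card X)"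
    using card_mono[OF W X] by linarith
  then have m: "(\<Sum>i\<in>I. real (card (Z i)) / real k) \<le> (real (card W) - real (card X)) / real k"
    using k by (simp add: sum_divide_distrib[symmetric] divide_right_mono)
  have "Q \<le> (\<Sum>i\<in>I. real (card (Z i)) / real k)\<^sup>2"
    unfolding Q_def by (rule sum_squares_le_square_sum) (use I in auto)
  also have "\<dots> \<le> ((real (card W) - real (card X)) / real k)\<^sup>2"
    using m by (intro power_mono sum_nonneg) auto
  finally have QM: "Q \<le> ((real (card W) - real (card X)) / real k)\<^sup>2" .
  have s': "0 \<le> 1 / s - 1" using s by simp
  from mult_right_mono[OF QM s']
  have qs: "Q / s - Q \<le> ((real (card W) - real (card X)) / real k)\<^sup>2 * (1 / s - 1)"
    by (simp add: algebra_simps)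
  have "real (card F) + real (card N) + real (card U) \<le> real (card W) * real (card W)"
    using c1 by (metis of_nat_add of_nat_le_iff of_nat_mult)
  then have "(real (card F) + real (card N) + real (card U)) / (real k)\<^sup>2 \<le> (real (card W) * real (card W)) / (real k)\<^sup>2"
    by (rule divide_right_mono) simp
  then have "real (card F) / (real k)\<^sup>2 + real (card N) / (real k)\<^sup>2 + Q \<le> (excess k W + 1)\<^sup>2"
    unfolding Q excess_def by (simp add: add_divide_distrib power2_eq_square)
  with qs show "real (card F) / (real k)\<^sup>2 \<le> 2 * excess k W +
      (1 + (excess k W)\<^sup>2 - real (card N) / (real k)\<^sup>2
       + ((real (card W) - real (card X)) / real k)\<^sup>2 * (1 / s - 1)) -
      (\<Sum>i\<in>I. (real (card (Z i)) / real k)\<^sup>2) / s"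
    unfolding Q_def[symmetric] by (simp add: power2_sum)
qed

lemma weighted_square_ineq:
  fixes x y r s :: real
  assumes "0 < r" "0 < s"
  shows "(x + y)\<^sup>2 / (r + s) \<le> x\<^sup>2 / r + y\<^sup>2 / s"
proof -
  have "x\<^sup>2 / r + y\<^sup>2 / s - (x + y)\<^sup>2 / (r + s) = (s * x - r * y)\<^sup>2 / (r * s * (r + s))"
    using assms by (simp add: divide_simps) (simp add: power2_eq_square algebra_simps)
  also have "\<dots> \<ge> 0" using assms by simp
  finally show ?thesis by simp
qed

lemma excess_Un:
  assumes "k > 0" "finite A" "finite B" "card (A \<inter> B) = k"
  shows "excess k (A \<union> B) = excess k A + excess k B"
proof -
  have "card A + card B = card (A \<union> B) + k"
    using card_Un_Int[OF assms(2,3)] assms(4) by simp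
  then have "real (card A) + real (card B) = real (card (A \<union> B)) + real k"
    by (metis of_nat_add)
  then have "(real (card A) + real (card B)) / real k = (real (card (A \<union> B)) + real k) / real k" by simp
  then show ?thesis using assms(1) unfolding excess_def by (simp add: add_divide_distrib)
qed

lemma arc_bound_Un:
  assumes k: "k > 0" and fin: "finite A" "finite B" and Y: "card (A \<inter> B) = k"
    and E: "E \<inter> ((A \<union> B) \<times> (A \<union> B)) \<subseteq> A \<times> A \<union> B \<times> B"
    and r: "0 < r" "0 < s"
    and bA: "arc_bound k E A (X \<inter> A) (N \<inter> A \<times> A) r c"
    and bB: "arc_bound k E B (A \<inter> B \<union> X \<inter> B) ((A \<inter> B) \<times> (A \<inter> B) \<union> N \<inter> B \<times> B) s d"
  shows "arc_bound k E (A \<union> B) X N (r + s) (c + d)"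
proof (rule arc_boundI)
  fix F and I :: "nat set" and Z
  assume F: "F \<subseteq> E \<inter> ((A \<union> B) \<times> (A \<union> B)) - N" and I: "finite I" and Z: "disjoint_family_on Z I"
    "\<And>i. i \<in> I \<Longrightarrow> Z i \<subseteq> (A \<union> B) - X" "\<And>i. i \<in> I \<Longrightarrow> F \<inter> (Z i \<times> Z i) = {}"
  \<comment> \<open>The anticliques are cut like the arcs: the separator belongs to the side of
    \<open>A\<close>, so the traces on \<open>B - A\<close> avoid the set that is forbidden in
    \<open>B\<close>.\<close>
  define u where "u i = real (card (Z i \<inter> A)) / real k" for i
  define v where "v i = real (card (Z i \<inter> (B - A))) / real k" for i
  have FA: "real (card (F \<inter> A \<times> A)) / (real k)\<^sup>2 \<le> 2 * excess k A + c - (\<Sum>i\<in>I. (u i)\<^sup>2) / r"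
    unfolding u_def
  proof (rule arc_boundD[OF bA])
    show "disjoint_family_on (\<lambda>i. Z i \<inter> A) I" using Z(1) by (auto simp: disjoint_family_on_def)
    show "F \<inter> A \<times> A \<inter> (Z i \<inter> A) \<times> (Z i \<inter> A) = {}" if "i \<in> I" for i using Z(3)[OF that] by blast
  qed (use F I Z(2) in auto)
  have FB: "real (card (F - A \<times> A)) / (real k)\<^sup>2 \<le> 2 * excess k B + d - (\<Sum>i\<in>I. (v i)\<^sup>2) / s"
    unfolding v_def
  proof (rule arc_boundD[OF bB])
    show "disjoint_family_on (\<lambda>i. Z i \<inter> (B - A)) I" using Z(1) by (auto simp: disjoint_family_on_def)
    show "(F - A \<times> A) \<inter> (Z i \<inter> (B - A)) \<times> (Z i \<inter> (B - A)) = {}" if "i \<in> I" for i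
      using Z(3)[OF that] by blast
    show "F - A \<times> A \<subseteq> E \<inter> B \<times> B - ((A \<inter> B) \<times> (A \<inter> B) \<union> N \<inter> B \<times> B)"
      using F E by blast
  qed (use I Z(2) in auto)
  have finF: "finite F"
    using F fin by (auto intro: finite_subset[of _ "(A \<union> B) \<times> (A \<union> B)"])
  have "card F = card (F \<inter> A \<times> A) + card (F - A \<times> A)"
    using finF by (subst card_Un_disjoint[symmetric]) (auto simp: Int_Diff_Un)
  then have cF: "real (card F) / (real k)\<^sup>2 = real (card (F \<inter> A \<times> A)) / (real k)\<^sup>2 + real (card (F - A \<times> A)) / (real k)\<^sup>2"
    by (simp add: add_divide_distrib)
  have cZ: "real (card (Z i)) / real k = u i + v i" if "i \<in> I" for i
  proof -
    have "Z i = (Z i \<inter> A) \<union> (Z i \<inter> (B - A))" using Z(2)[OF that] by blast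
    moreover have "card ((Z i \<inter> A) \<union> (Z i \<inter> (B - A))) = card (Z i \<inter> A) + card (Z i \<inter> (B - A))"
      using fin by (intro card_Un_disjoint) auto
    ultimately show ?thesis unfolding u_def v_def by (metis add_divide_distrib of_nat_add)
  qed
  have "(\<Sum>i\<in>I. (real (card (Z i)) / real k)\<^sup>2) / (r + s) = (\<Sum>i\<in>I. (u i + v i)\<^sup>2 / (r + s))"
    using cZ by (simp add: sum_divide_distrib)
  also have "\<dots> \<le> (\<Sum>i\<in>I. (u i)\<^sup>2 / r + (v i)\<^sup>2 / s)"
    using r by (intro sum_mono weighted_square_ineq)
  also have "\<dots> = (\<Sum>i\<in>I. (u i)\<^sup>2) / r + (\<Sum>i\<in>I. (v i)\<^sup>2) / s"
    by (simp add: sum.distrib sum_divide_distrib)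
  finally show "real (card F) / (real k)\<^sup>2 \<le> 2 * excess k (A \<union> B) + (c + d) -
      (\<Sum>i\<in>I. (real (card (Z i)) / real k)\<^sup>2) / (r + s)"
    using FA FB cF excess_Un[OF k fin Y] by (simp add: algebra_simps)
qed

text \<open>An \<open>F\<close> without arcs inside \<open>X\<close> has \<open>X\<close> itself as
  an anticlique, disjoint from those that avoid \<open>X\<close>. Adding it to the family under a
  fresh index \<open>j\<close> yields the gain.\<close>

lemma arc_bound_forbid:
  assumes k: "k > 0" and b: "arc_bound k E W {} {} r c" and X: "X \<subseteq> W"
  shows "arc_bound k E W X (X \<times> X) r (c - (real (card X) / real k)\<^sup>2 / r)"
proof (rule arc_boundI)
  fix F and I :: "nat set" and Z
  assume F: "F \<subseteq> E \<inter> (W \<times> W) - X \<times> X" and I: "finite I" and Z: "disjoint_family_on Z I"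
    "\<And>i. i \<in> I \<Longrightarrow> Z i \<subseteq> W - X" "\<And>i. i \<in> I \<Longrightarrow> F \<inter> (Z i \<times> Z i) = {}"
  obtain j where j: "j \<notin> I" using ex_new_if_finite[OF infinite_UNIV_nat I] by auto
  define Z' where "Z' = Z(j := X)"
  have Z': "Z' i = Z i" if "i \<in> I" for i using that j by (auto simp: Z'_def)
  have [simp]: "Z' j = X" by (simp add: Z'_def)
  have "real (card F) / (real k)\<^sup>2 \<le> 2 * excess k W + c - (\<Sum>i\<in>insert j I. (real (card (Z' i)) / real k)\<^sup>2) / r"
  proof (rule arc_boundD[OF b])
    show "disjoint_family_on Z' (insert j I)"
    unfolding disjoint_family_on_def
    proof (intro ballI impI)
      fix m n assume mn: "m \<in> insert j I" "n \<in> insert j I" "m \<noteq> n"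
      have "X \<inter> Z i = {}" if "i \<in> I" for i using Z(2)[OF that] by blast
      with mn show "Z' m \<inter> Z' n = {}"
        using disjoint_family_onD[OF Z(1), of m n] j unfolding Z'_def by (cases "m = j"; cases "n = j") auto
    qed
    show "Z' i \<subseteq> W - {}" if "i \<in> insert j I" for i
    proof (cases "i = j")
      case False
      then show ?thesis using that Z(2)[of i] Z'[of i] by blast
    qed (use X in simp)
    show "F \<inter> Z' i \<times> Z' i = {}" if "i \<in> insert j I" for i
    proof (cases "i = j")
      case False
      then show ?thesis using that Z(3)[of i] Z'[of i] by simp
    qed (use F in auto)
  qed (use F I in auto)
  then show "real (card F) / (real k)\<^sup>2 \<le> 2 * excess k W + (c - (real (card X) / real k)\<^sup>2 / r) -
      (\<Sum>i\<in>I. (real (card (Z i)) / real k)\<^sup>2) / r"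
    using I j Z' by (simp add: add_divide_distrib)
qed

section \<open>Separations of vertex sets and the attachment of one part\<close>

text \<open>Separating induced subgraphs is enough: a separation of \<open>W\<close> with respect to
  \<open>E\<close> also divides the arcs of every \<open>F\<close> contained in \<open>E\<close>, so
  all spanning subgraphs are treated at once.\<close>

locale separable_arcs =
  fixes k :: nat and V :: "'a set" and E :: "('a \<times> 'a) set" and \<sigma> :: real
  assumes k_pos: "k > 0" and finite_V: "finite V"
    and separation: "\<And>W. W \<subseteq> V \<Longrightarrow> \<sigma> < excess k W \<Longrightarrow>
      \<exists>A B. W = A \<union> B \<and> A \<noteq> W \<and> B \<noteq> W \<and> card (A \<inter> B) = k \<and> E \<inter> W \<times> W \<subseteq> A \<times> A \<union> B \<times> B"
begin

abbreviation ex :: "'a set \<Rightarrow> real" where "ex \<equiv> excess k"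

abbreviation bounded :: "'a set \<Rightarrow> real \<Rightarrow> real \<Rightarrow> bool" where
  "bounded W \<equiv> arc_bound k E W {} {}"

definition splits :: "'a set \<Rightarrow> 'a set \<Rightarrow> 'a set \<Rightarrow> bool" where
  "splits W A B \<longleftrightarrow> W \<subseteq> V \<and> W = A \<union> B \<and> A \<noteq> W \<and> B \<noteq> W \<and> card (A \<inter> B) = k \<and>
     E \<inter> W \<times> W \<subseteq> A \<times> A \<union> B \<times> B"

lemma splits_sym: "splits W A B \<Longrightarrow> splits W B A"
  unfolding splits_def by (auto simp: Un_commute Int_commute)

lemma splits_finite:
  assumes "splits W A B"
  shows "finite W" "finite A" "finite B" "A \<subseteq> V" "B \<subseteq> V"
  using assms finite_subset[OF _ finite_V] unfolding splits_def by auto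

lemma splits_excess:
  assumes "splits W A B"
  shows "ex W = ex A + ex B" "0 < ex A" "0 < ex B" "card A < card W" "card B < card W"
proof -
  note fin = splits_finite[OF assms]
  have *: "W = A \<union> B" "A \<noteq> W" "B \<noteq> W" "card (A \<inter> B) = k"
    using assms unfolding splits_def by auto
  show "ex W = ex A + ex B"
    using excess_Un[OF k_pos fin(2,3) *(4)] *(1) by simp
  have "card (A \<inter> B) < card A" "card (A \<inter> B) < card B"
    using * fin by (auto intro!: psubset_card_mono)
  then show "0 < ex A" "0 < ex B"
    using *(4) k_pos by (auto simp: excess_def field_simps)
  show "card A < card W" "card B < card W"
    using * fin by (auto intro!: psubset_card_mono)
qed

lemma splits_exists:
  assumes "W \<subseteq> V" "\<sigma> < ex W"
  obtains A B where "splits W A B" "ex B \<le> ex A"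
proof -
  obtain A B where "splits W A B"
    using separation[OF assms] assms(1) unfolding splits_def by blast
  then show thesis using that splits_sym by (meson linear)
qed

lemma bounded_merge:
  assumes "splits W A B" "bounded A r c" "arc_bound k E B (A \<inter> B) ((A \<inter> B) \<times> (A \<inter> B)) s d" "0 < r" "0 < s"
  shows "bounded W (r + s) (c + d)"
proof -
  have "arc_bound k E (A \<union> B) {} {} (r + s) (c + d)"
    using assms splits_finite[OF assms(1)] k_pos unfolding splits_def
    by (intro arc_bound_Un) auto
  then show ?thesis using assms(1) unfolding splits_def by simp
qed

text \<open>The forbidden pairs of the separator cancel the summand 1 of the complete graph on
  \<open>B\<close>; what remains is \<open>b\<^sup>2 + b\<^sup>2 * (1 / s - 1)\<close> for
  \<open>b = ex B\<close>.\<close>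

lemma bounded_attach:
  assumes sp: "splits W A B" and A: "bounded A r c" and rs: "0 < r" "0 < s" "s \<le> 1"
  shows "bounded W (r + s) (c + (ex B)\<^sup>2 / s)"
proof -
  have Y: "card (A \<inter> B) = k" using sp unfolding splits_def by simp
  have fin: "finite B" using splits_finite[OF sp] by simp
  have "arc_bound k E B (A \<inter> B) ((A \<inter> B) \<times> (A \<inter> B)) s
    (1 + (ex B)\<^sup>2 - real (card ((A \<inter> B) \<times> (A \<inter> B))) / (real k)\<^sup>2
       + ((real (card B) - real (card (A \<inter> B))) / real k)\<^sup>2 * (1 / s - 1))"
    using rs fin k_pos by (intro arc_bound_leaf) auto
  moreover have "real (card ((A \<inter> B) \<times> (A \<inter> B))) / (real k)\<^sup>2 = 1"
    using k_pos by (simp add: card_cartesian_product Y power2_eq_square)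
  moreover have "(real (card B) - real (card (A \<inter> B))) / real k = ex B"
    using k_pos by (simp add: Y excess_def diff_divide_distrib)
  ultimately have "arc_bound k E B (A \<inter> B) ((A \<inter> B) \<times> (A \<inter> B)) s
      (1 + (ex B)\<^sup>2 - 1 + (ex B)\<^sup>2 * (1 / s - 1))" by simp
  also have "1 + (ex B)\<^sup>2 - 1 + (ex B)\<^sup>2 * (1 / s - 1) = (ex B)\<^sup>2 / s"
    by (simp add: algebra_simps)
  finally show ?thesis using bounded_merge[OF sp A _ rs(1,2)] by blast
qed

lemma bounded_leaf: "W \<subseteq> V \<Longrightarrow> bounded W 1 (1 + (ex W)\<^sup>2)"
  using arc_bound_leaf[of k W "{}" "{}" 1 E] k_pos finite_subset[OF _ finite_V] by simp

section \<open>Inheritance of the claimed bound under separation\<close>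

text \<open>\<open>D\<close> stands for \<delta> - 2, since \<open>arc_bound\<close> already
  contains the summand \<open>2 * excess k W\<close>.\<close>

definition good :: "real \<Rightarrow> 'a set \<Rightarrow> real \<Rightarrow> bool" where
  "good D W r \<longleftrightarrow> bounded W r (D * ex W + 2 / (3 * r))"

lemma goodI:
  assumes "bounded W r c" "0 < r" "r \<le> r'" "c \<le> D * ex W + 2 / (3 * r')"
  shows "good D W r'"
  using arc_bound_mono[OF assms] unfolding good_def .

text \<open>The saving \<open>1 / s\<close> is larger on the side of smaller weight, so that side
  takes the role of \<open>B\<close>. The numerical inequality is an equality for
  \<open>r = s\<close>.\<close>

lemma good_merge:
  assumes sp: "splits W A B" and g: "good D A r" "good D B s" and rs: "0 < r" "0 < s"
  shows "good D W (r + s)"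
proof -
  have key: "good D W (r + s)"
    if sp: "splits W A B" and gA: "good D A r" and gB: "good D B s" and sr: "s \<le> r" and s: "0 < s"
    for A B r s
  proof -
    have Y: "card (A \<inter> B) = k" using sp unfolding splits_def by simp
    have "arc_bound k E B (A \<inter> B) ((A \<inter> B) \<times> (A \<inter> B)) s
        (D * ex B + 2 / (3 * s) - (real (card (A \<inter> B)) / real k)\<^sup>2 / s)"
      using gB k_pos unfolding good_def by (intro arc_bound_forbid) auto
    then have "bounded W (r + s) (D * ex A + 2 / (3 * r) + (D * ex B + 2 / (3 * s) - 1 / s))"
      using gA sr s k_pos unfolding good_def by (intro bounded_merge[OF sp]) (auto simp: Y)
    moreover have "2 / (3 * r) + 2 / (3 * s) - 1 / s \<le> 2 / (3 * (r + s))"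
    proof -
      have "2 / (3 * (r + s)) - (2 / (3 * r) + 2 / (3 * s) - 1 / s)
          = (r - s) * (r + 2 * s) / (3 * r * s * (r + s))"
        using sr s by (simp add: divide_simps) (simp add: algebra_simps)
      also have "\<dots> \<ge> 0" using sr s by simp
      finally show ?thesis by simp
    qed
    ultimately show ?thesis
      using sr s splits_excess(1)[OF sp]
      by (intro goodI[of W "r + s" "D * ex A + 2 / (3 * r) + (D * ex B + 2 / (3 * s) - 1 / s)"])
        (auto simp: algebra_simps)
  qed
  show ?thesis
  proof (cases "s \<le> r")
    case True
    then show ?thesis using key[OF sp g] rs by simp
  next
    case False
    then show ?thesis using key[OF splits_sym[OF sp] g(2,1)] rs by (simp add: add.commute)
  qed
qed

text \<open>The loss \<open>2 / (3 * r) - 2 / (3 * (r + s))\<close> decreases in \<open>r\<close>,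
  so \<open>r = \<rho>\<close> is the worst case.\<close>

lemma good_attach:
  assumes sp: "splits W A B" and A: "good D A r" and r: "0 < \<rho>" "\<rho> \<le> r" and s: "0 < s" "s \<le> 1"
    and le: "(ex B)\<^sup>2 / s + 2 / 3 * (s / (\<rho> * (\<rho> + s))) \<le> D * ex B"
  shows "good D W (r + s)"
proof -
  have "bounded W (r + s) (D * ex A + 2 / (3 * r) + (ex B)\<^sup>2 / s)"
    using A r s unfolding good_def by (intro bounded_attach[OF sp]) auto
  moreover have "2 / (3 * r) - 2 / (3 * (r + s)) \<le> 2 / 3 * (s / (\<rho> * (\<rho> + s)))"
  proof -
    have "2 / (3 * r) - 2 / (3 * (r + s)) = 2 / 3 * (s / (r * (r + s)))"
      using r s by (simp add: divide_simps)
    also have "\<dots> \<le> 2 / 3 * (s / (\<rho> * (\<rho> + s)))"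
      using r s by (intro mult_left_mono divide_left_mono mult_mono) auto
    finally show ?thesis .
  qed
  ultimately show ?thesis
    using r s le splits_excess(1)[OF sp]
    by (intro goodI[of W "r + s" "D * ex A + 2 / (3 * r) + (ex B)\<^sup>2 / s"]) (auto simp: algebra_simps)
qed

text \<open>Two parts of size at least \<gamma> are merged by \<open>good_merge\<close>; the three
  hypotheses are the cases that remain for each alternative.\<close>

lemma good_induct:
  assumes \<rho>: "0 < \<rho>"
    and small: "\<And>W. W \<subseteq> V \<Longrightarrow> \<gamma> \<le> ex W \<Longrightarrow> ex W \<le> \<sigma> \<Longrightarrow> \<exists>r\<ge>\<rho>. good D W r"
    and base: "\<And>W A B. splits W A B \<Longrightarrow> \<gamma> \<le> ex W \<Longrightarrow> \<sigma> < ex W \<Longrightarrow> ex B \<le> ex A \<Longrightarrow> ex A < \<gamma> \<Longrightarrow>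
      \<exists>r\<ge>\<rho>. good D W r"
    and attach: "\<And>W A B r. splits W A B \<Longrightarrow> \<gamma> \<le> ex A \<Longrightarrow> ex B < \<gamma> \<Longrightarrow> good D A r \<Longrightarrow> \<rho> \<le> r \<Longrightarrow>
      \<exists>r'\<ge>\<rho>. good D W r'"
  shows "W \<subseteq> V \<Longrightarrow> \<gamma> \<le> ex W \<Longrightarrow> \<exists>r\<ge>\<rho>. good D W r"
proof (induction "card W" arbitrary: W rule: less_induct)
  case less
  show ?case
  proof (cases "ex W \<le> \<sigma>")
    case True
    then show ?thesis using small less.prems by blast
  next
    case False
    then have "\<sigma> < ex W" by simp
    then obtain A B where sp: "splits W A B" and AB: "ex B \<le> ex A"
      by (rule splits_exists[OF less.prems(1)])
    note fin = splits_finite[OF sp] and sz = splits_excess[OF sp]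
    show ?thesis
    proof (cases "ex A < \<gamma>")
      case True
      then show ?thesis using base[OF sp] less.prems False AB by auto
    next
      case A: False
      then obtain r where r: "r \<ge> \<rho>" "good D A r" using less.hyps[of A] sz fin by auto
      show ?thesis
      proof (cases "ex B < \<gamma>")
        case True
        then show ?thesis using attach[OF sp] A r by auto
      next
        case B: False
        then obtain s where "s \<ge> \<rho>" "good D B s" using less.hyps[of B] sz fin by auto
        then show ?thesis using good_merge[OF sp r(2), of s] r \<rho> by (intro exI[of _ "r + s"]) auto
      qed
    qed
  qed
qed

section \<open>The case of large separability\<close>

lemma good_large_separability:
  assumes \<sigma>: "\<sigma> \<ge> (sqrt 2 + 1) / sqrt 3" and W: "W \<subseteq> V" "1 / (3 * \<sigma>) \<le> ex W"
  shows "\<exists>r\<ge>1. good (\<sigma> + 1 / (3 * \<sigma>)) W r"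
proof -
  define \<gamma> where "\<gamma> = 1 / (3 * \<sigma>)"
  have s3: "0 < sqrt 3" by simp
  have \<sigma>3: "sqrt 2 + 1 \<le> \<sigma> * sqrt 3"
    using \<sigma> by (simp add: divide_simps)
  have s2: "1.4 \<le> sqrt 2" by (rule real_le_rsqrt) (simp add: power2_eq_square)
  have "sqrt 3 \<le> 1.8" by (rule real_le_lsqrt) (auto simp: power2_eq_square)
  have \<sigma>1: "1.3 \<le> \<sigma>"
  proof (rule ccontr)
    assume "\<not> 1.3 \<le> \<sigma>"
    then have "\<sigma> * sqrt 3 < 1.3 * sqrt 3" using s3 by simp
    with \<open>sqrt 3 \<le> 1.8\<close> \<sigma>3 s2 show False by simp
  qed
  have "1.3 * 1.3 \<le> \<sigma> * \<sigma>" using \<sigma>1 by (intro mult_mono) auto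
  with \<sigma>1 have \<gamma>: "0 < \<gamma>" "\<gamma> \<le> 1 / 3" "2 * \<gamma> < \<sigma>"
    unfolding \<gamma>_def by (auto simp: divide_simps)
  have prod: "\<sigma> * \<gamma> = 1 / 3" using \<sigma>1 unfolding \<gamma>_def by simp
  \<comment> \<open>A part of size \<open>b\<close> is attached with weight \<open>\<theta> b\<close>; this \<open>\<theta>\<close> minimises \<open>2 / 3 * \<theta> + 1 / \<theta>\<close>, and the
    condition on \<open>\<sigma>\<close> says that the minimum is at most \<open>\<sigma> + \<gamma>\<close>.\<close>
  define \<theta> where "\<theta> = sqrt (3 / 2)"
  have \<theta>: "0 < \<theta>" "\<theta>\<^sup>2 = 3 / 2" "\<theta> \<le> 2"
    unfolding \<theta>_def by (auto intro!: real_le_lsqrt)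
  have two_thirds: "2 / 3 * \<theta> + 1 / \<theta> \<le> \<sigma> + \<gamma>"
  proof -
    have e1: "2 / 3 * \<theta> + 1 / \<theta> = 4 / 3 * \<theta>"
      using \<theta> by (simp add: field_simps power2_eq_square)
    define x where "x = \<sigma> * sqrt 3"
    have x: "sqrt 2 + 1 \<le> x" using \<sigma>3 unfolding x_def .
    then have xpos: "0 < x" using s2 by linarith
    \<comment> \<open>The numbers \<open>sqrt 2 + 1\<close> and \<open>sqrt 2 - 1\<close> are the
      roots of \<open>x\<^sup>2 - 2 * sqrt 2 * x + 1\<close>. This is where the lower bound on
      \<sigma> comes from.\<close>
    have "0 \<le> (x - (sqrt 2 + 1)) * (x - (sqrt 2 - 1))"
      using x by (intro mult_nonneg_nonneg) auto
    also have "\<dots> = x * x - 2 * sqrt 2 * x + 1" by (simp add: algebra_simps)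
    finally have "2 * sqrt 2 * x \<le> x * x + 1" by simp
    then have "2 * sqrt 2 \<le> x + 1 / x" using xpos by (simp add: field_simps)
    also have "x + 1 / x = sqrt 3 * (\<sigma> + \<gamma>)"
      using \<sigma>1 unfolding x_def \<gamma>_def by (simp add: field_simps)
    finally have "2 * sqrt 2 \<le> sqrt 3 * (\<sigma> + \<gamma>)" .
    moreover have "sqrt 3 * (4 / 3 * \<theta>) = 2 * sqrt 2"
      unfolding \<theta>_def by (simp add: real_sqrt_divide field_simps)
    ultimately have "sqrt 3 * (4 / 3 * \<theta>) \<le> sqrt 3 * (\<sigma> + \<gamma>)" by linarith
    then have "4 / 3 * \<theta> \<le> \<sigma> + \<gamma>" by (rule mult_left_le_imp_le[OF _ s3])
    with e1 show ?thesis by simp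
  qed
  have "\<exists>r\<ge>1. good (\<sigma> + \<gamma>) W r"
  proof (rule good_induct[where \<gamma> = \<gamma>])
    fix U assume U: "U \<subseteq> V" "\<gamma> \<le> ex U" "ex U \<le> \<sigma>"
    \<comment> \<open>As the product of \<gamma> and \<sigma> is \<open>1 / 3\<close>, they are the
      two sizes at which a complete graph of weight 1 meets the claim with equality.\<close>
    have "0 \<le> (ex U - \<gamma>) * (\<sigma> - ex U)" using U by simp
    then have "1 + (ex U)\<^sup>2 \<le> (\<sigma> + \<gamma>) * ex U + 2 / (3 * 1)"
      using prod by (simp add: algebra_simps power2_eq_square)
    then have "good (\<sigma> + \<gamma>) U 1" using bounded_leaf[OF U(1)] by (intro goodI) auto
    then show "\<exists>r\<ge>1. good (\<sigma> + \<gamma>) U r" by auto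
  next
    fix U A B assume "splits U A B" "\<sigma> < ex U" "ex B \<le> ex A" "ex A < \<gamma>"
    \<comment> \<open>This case is void: the total size would be below \<open>2 * \<gamma>\<close>,
      hence below \<sigma>.\<close>
    then show "\<exists>r\<ge>1. good (\<sigma> + \<gamma>) U r" using splits_excess(1) \<gamma> by fastforce
  next
    fix U A B r assume sp: "splits U A B" and B: "ex B < \<gamma>" and A: "good (\<sigma> + \<gamma>) A r" "1 \<le> r"
    have b: "0 < ex B" using splits_excess[OF sp] by simp
    have s1: "0 < \<theta> * ex B" using b \<theta> by simp
    have "\<theta> * ex B \<le> 2 * (1 / 3)" using b \<theta> B \<gamma> by (intro mult_mono) auto
    then have s2: "\<theta> * ex B \<le> 1" by simp
    have "(ex B)\<^sup>2 / (\<theta> * ex B) + 2 / 3 * (\<theta> * ex B / (1 * (1 + \<theta> * ex B)))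
        \<le> (ex B)\<^sup>2 / (\<theta> * ex B) + 2 / 3 * (\<theta> * ex B / 1)"
      using s1 by (intro add_left_mono mult_left_mono divide_left_mono) auto
    also have "\<dots> = (2 / 3 * \<theta> + 1 / \<theta>) * ex B"
      using b \<theta> by (simp add: field_simps power2_eq_square)
    also have "\<dots> \<le> (\<sigma> + \<gamma>) * ex B" using two_thirds b by (intro mult_right_mono) auto
    finally have "good (\<sigma> + \<gamma>) U (r + \<theta> * ex B)"
      using s1 s2 A by (intro good_attach[OF sp, where \<rho> = 1]) auto
    then show "\<exists>r'\<ge>1. good (\<sigma> + \<gamma>) U r'" using A s1 by (intro exI[of _ "r + \<theta> * ex B"]) auto
  qed (use W \<gamma>_def in auto)
  then show ?thesis by (simp add: \<gamma>_def)
qed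

end

section \<open>From digraphs to vertex sets and arc sets\<close>

lemma separable_arcs_digraph:
  assumes k: "k > 0" and G: "pair_fin_digraph G" and sep: "separable k \<sigma> G"
  shows "separable_arcs k (pverts G) (parcs G) \<sigma>"
proof
  interpret pair_fin_digraph G by (rule G)
  show "k > 0" by (rule k)
  show "finite (pverts G)" by (rule pair_finite_verts)
  fix W assume W: "W \<subseteq> pverts G" "\<sigma> < excess k W"
  define C where "C = \<lparr>pverts = W, parcs = parcs G \<inter> W \<times> W\<rparr>"
  have [simp]: "pverts C = W" "parcs C = parcs G \<inter> W \<times> W" unfolding C_def by auto
  have "subgraph (with_proj C) (with_proj G)"
    using W(1) wf_digraph unfolding subgraph_def compatible_def
    by (auto intro!: wf_digraph.intro)
  moreover have "nverts k C > 1 + \<sigma>" using W(2) by (simp add: nverts_def excess_def)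
  ultimately obtain A B where "graph_separation k C A B" using sep unfolding separable_def by blast
  then have AB: "induced_subgraph (with_proj A) (with_proj C)" "\<not> spanning (with_proj A) (with_proj C)"
    "induced_subgraph (with_proj B) (with_proj C)" "\<not> spanning (with_proj B) (with_proj C)"
    "pverts A \<union> pverts B = W" "parcs A \<union> parcs B = parcs G \<inter> W \<times> W" "card (pverts A \<inter> pverts B) = k"
    unfolding graph_separation_def by auto
  have "pverts A \<noteq> W" "pverts B \<noteq> W"
    using AB(1-4) unfolding induced_subgraph_def spanning_def by auto
  moreover have "parcs A \<subseteq> pverts A \<times> pverts A" "parcs B \<subseteq> pverts B \<times> pverts B"
    using AB(1,3) unfolding induced_subgraph_def by auto
  ultimately show "\<exists>A B. W = A \<union> B \<and> A \<noteq> W \<and> B \<noteq> W \<and> card (A \<inter> B) = k \<and> parcs G \<inter> W \<times> W \<subseteq> A \<times> A \<union> B \<times> B"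
    using AB(5-7) by (intro exI[of _ "pverts A"] exI[of _ "pverts B"]) auto
qed

lemma arc_bound_anticliques:
  fixes G G' :: "'a pair_pre_digraph" and A :: "nat \<Rightarrow> 'a pair_pre_digraph"
  assumes b: "arc_bound k (parcs G) (pverts G) {} {} r c"
    and sp: "spanning (with_proj G') (with_proj G)"
    and A: "\<forall>i\<in>{1..l}. anticlique (A i) G'"
    and dis: "disjoint_family_on (\<lambda>i. pverts (A i)) {1..l}"
  shows "narcs k G' \<le> 2 * (nverts k G - 1) + c - (\<Sum>i=1..l. (nverts k (A i))\<^sup>2) / r"
proof -
  have sub: "parcs G' \<subseteq> parcs G" "pverts G' = pverts G" "wf_digraph (with_proj G')"
    using sp unfolding spanning_def subgraph_def by auto
  have arcs: "parcs G' \<subseteq> pverts G' \<times> pverts G'"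
    using wf_digraph.tail_in_verts[OF sub(3)] wf_digraph.head_in_verts[OF sub(3)] by fastforce
  have "real (card (parcs G')) / (real k)\<^sup>2
      \<le> 2 * excess k (pverts G) + c - (\<Sum>i\<in>{1..l}. (real (card (pverts (A i))) / real k)\<^sup>2) / r"
  proof (rule arc_boundD[OF b])
    fix i assume "i \<in> {1..l}"
    then have i: "induced_subgraph (with_proj (A i)) (with_proj G')" "parcs (A i) = {}"
      using A unfolding anticlique_def by auto
    show "pverts (A i) \<subseteq> pverts G - {}"
      using i(1) sub(2) unfolding induced_subgraph_def subgraph_def by auto
    show "parcs G' \<inter> pverts (A i) \<times> pverts (A i) = {}"
      using i unfolding induced_subgraph_def by auto
  qed (use sub arcs dis in auto)
  then show ?thesis unfolding narcs_def nverts_def excess_def by simp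
qed

section \<open>The case of separability sqrt 10 / 6\<close>

text \<open>By convexity the graph of \<open>2 / (3 * x)\<close> lies above its tangent at
  \<open>a\<close>. Such tangents make the estimates linear in the weight.\<close>

lemma reciprocal_tangent:
  fixes x a :: real
  assumes "0 < x" "0 < a"
  shows "4 / (3 * a) - 2 * x / (3 * a\<^sup>2) \<le> 2 / (3 * x)"
proof -
  have "2 / (3 * x) - (4 / (3 * a) - 2 * x / (3 * a\<^sup>2)) = 2 * (x - a)\<^sup>2 / (3 * x * a\<^sup>2)"
    using assms by (simp add: divide_simps) (simp add: power2_eq_square algebra_simps)
  also have "\<dots> \<ge> 0" using assms by simp
  finally show ?thesis by simp
qed

lemma square_le_mult: "0 \<le> x \<Longrightarrow> x \<le> c \<Longrightarrow> x\<^sup>2 \<le> c * (x :: real)"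
  by (simp add: power2_eq_square mult_right_mono)

text \<open>
  Up to total size \<open>2 \<sigma>\<close>, repeated separation leaves a core of size \<open>c\<close> in \<open>[\<sigma> / 2, \<sigma>]\<close> and at most one part
  \<open>q > 2 / 5\<close>; that part gets weight 1 and every other part \<open>p\<close> gets weight \<open>5 / 2 * p\<close>. When the size
  passes \<open>2 \<sigma>\<close>, the resulting inequalities are sharp for two parts of size \<open>\<sigma>\<close> and for parts of
  size \<open>\<sigma>, \<sigma>, 2 \<sigma>\<close>.
\<close>

lemma cost_no_large_part:
  fixes s c P :: real
  assumes s: "(1647 / 3125) \<le> s" "s \<le> (10541 / 20000)" "s\<^sup>2 = 5 / 18"
    and c: "s / 2 \<le> c" "c \<le> s" and P: "2 * s - c \<le> P"
  shows "1 + c\<^sup>2 + 2 / 5 * P \<le> 11 / 5 * s * (c + P) + 2 / (3 * (1 + 5 / 2 * P))"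
proof -
  have P0: "0 < P" using s c P by linarith
  define R where "R = 2 / (3 * (1 + 5 / 2 * P))"
  have "4 / (3 * (5 / 2)) - 2 * (1 + 5 / 2 * P) / (3 * (5 / 2)\<^sup>2) \<le> R"
    unfolding R_def using P0 by (intro reciprocal_tangent) auto
  then have t: "32 / 75 - 4 / 15 * P \<le> R"
    by (simp add: power2_eq_square field_simps)
  have "(c - s / 2) * (c - s) \<le> 0" using c by (intro mult_nonneg_nonpos) auto
  moreover have "(c - s / 2) * (c - s) = c\<^sup>2 - 3 / 2 * (s * c) + s\<^sup>2 / 2"
    by (simp add: power2_eq_square field_simps)
  ultimately have c2: "c\<^sup>2 \<le> 3 / 2 * (s * c) - 5 / 36" using s(3) by linarith
  have sc: "(1647 / 3125) * c \<le> s * c" "s * c \<le> (10541 / 20000) * c"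
    using s c by (auto intro!: mult_right_mono)
  have sP: "(1647 / 3125) * P \<le> s * P" using s P0 by (intro mult_right_mono) auto
  have "11 / 5 * s * (c + P) = 11 / 5 * (s * c) + 11 / 5 * (s * P)" by (simp add: algebra_simps)
  with c2 sc sP t s c P show ?thesis unfolding R_def[symmetric] by linarith
qed

text \<open>Here \<open>u\<close> and \<open>v\<close> measure the distance from the sharp
  configuration \<open>c = q = s\<close>, \<open>P = 0\<close>, where both sides differ by nothing
  and the reciprocal term is \<open>1 / 3\<close>. The tangents at the weights 2 and
  \<open>21 / 8\<close> serve small and larger \<open>P\<close>; the two alternatives in
  \<open>main\<close> are what they require after the terms in \<open>P\<close> are
  collected.\<close>

lemma cost_one_large_part:
  fixes s c q P :: real
  assumes s: "(1647 / 3125) \<le> s" "s \<le> (10541 / 20000)" "s\<^sup>2 = 5 / 18"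
    and c: "s / 2 \<le> c" "c \<le> s" and q: "2 / 5 \<le> q" "q \<le> 2 * s"
    and P: "2 * s - c - q \<le> P" "q - c \<le> P" "0 \<le> P"
  shows "1 + c\<^sup>2 + q\<^sup>2 + 2 / 5 * P \<le> 11 / 5 * s * (c + q + P) + 2 / (3 * (2 + 5 / 2 * P))"
proof -
  define u where "u = s - c"
  define v where "v = s - q"
  have u: "0 \<le> u" "u \<le> (26353 / 100000)" using c s by (auto simp: u_def)
  define R where "R = 2 / (3 * (2 + 5 / 2 * P))"
  have t1: "1 / 3 - 5 / 12 * P \<le> R"
  proof -
    have "4 / (3 * 2) - 2 * (2 + 5 / 2 * P) / (3 * 2\<^sup>2) \<le> R"
      unfolding R_def using P by (intro reciprocal_tangent) auto
    then show ?thesis using P by (simp add: power2_eq_square field_simps)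
  qed
  have t2: "1 / 3 - (189 / 10000) - (121 / 500) * P \<le> R"
  proof -
    have "4 / (3 * (21 / 8)) - 2 * (2 + 5 / 2 * P) / (3 * (21 / 8)\<^sup>2) \<le> R"
      unfolding R_def using P by (intro reciprocal_tangent) auto
    then show ?thesis using P by (simp add: power2_eq_square field_simps)
  qed
  have sP: "(1647 / 3125) * P \<le> s * P" using s P by (intro mult_right_mono) auto
  have lhs: "1 + c\<^sup>2 + q\<^sup>2 + 2 / 5 * P - 11 / 5 * s * (c + q + P)
      = 1 / 3 + s / 5 * (u + v) + u\<^sup>2 + v\<^sup>2 + 2 / 5 * P - 11 / 5 * (s * P)"
    using s(3) unfolding u_def v_def by algebra
  have main: "s / 5 * (u + v) + u\<^sup>2 + v\<^sup>2 \<le> (3427 / 10000) * P \<or> s / 5 * (u + v) + u\<^sup>2 + v\<^sup>2 \<le> (2587 / 5000) * P - (189 / 10000)"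
  proof (cases "0 \<le> v")
    case True
    then have v: "0 \<le> v" "v \<le> (2541 / 20000)" "u + v \<le> P" using q s P by (auto simp: u_def v_def)
    have suv: "s / 5 * (u + v) \<le> (10541 / 100000) * (u + v)" using s u v by (intro mult_right_mono) auto
    show ?thesis
    proof (cases "u + v \<le> (13 / 100)")
      case True
      then have "u\<^sup>2 \<le> (13 / 100) * u" "v\<^sup>2 \<le> (13 / 100) * v"
        using u v by - (rule square_le_mult; linarith)+
      then show ?thesis using suv u v by (intro disjI1) argo
    next
      case False
      have "u\<^sup>2 \<le> (26353 / 100000) * u" "v\<^sup>2 \<le> (26353 / 100000) * v"
        using u v by - (rule square_le_mult; linarith)+
      then show ?thesis using suv u v False by (intro disjI2) argo
    qed
  next
    case False
    define w where "w = - v"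
    have w: "0 \<le> w" "w \<le> (10541 / 20000)" "u + w \<le> P" using False q s P by (auto simp: u_def v_def w_def)
    have su: "s / 5 * u \<le> 10541 / 100000 * u"
      by (rule mult_right_mono) (use s u in auto)
    have sw: "13176 / 125000 * w \<le> s / 5 * w"
      by (rule mult_right_mono) (use s w in auto)
    have e: "s / 5 * (u + v) + u\<^sup>2 + v\<^sup>2 = s / 5 * u - s / 5 * w + u\<^sup>2 + w\<^sup>2"
      unfolding w_def by (simp add: algebra_simps)
    consider "u + w \<le> (13 / 100)" | "(13 / 100) < u + w" "u + w \<le> (1 / 5)" | "(1 / 5) < u + w" by linarith
    then show ?thesis
    proof cases
      case 1
      then have "u\<^sup>2 \<le> (13 / 100) * u" "w\<^sup>2 \<le> (13 / 100) * w"
        using u w by - (rule square_le_mult; linarith)+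
      then show ?thesis using su sw u w e by (intro disjI1) argo
    next
      case 2
      then have "u\<^sup>2 \<le> (1 / 5) * u" "w\<^sup>2 \<le> (1 / 5) * w"
        using u w by - (rule square_le_mult; linarith)+
      then show ?thesis using su sw u w e 2 by (intro disjI2) argo
    next
      case 3
      have "u\<^sup>2 \<le> (26353 / 100000) * u" "w\<^sup>2 \<le> (10541 / 20000) * w"
        using u w by - (rule square_le_mult; linarith)+
      then show ?thesis using su sw u w e 3 by (intro disjI2) argo
    qed
  qed
  then show ?thesis using lhs t1 t2 sP P unfolding R_def[symmetric] by (elim disjE) argo+
qed

text \<open>The sharp configuration is \<open>c = q = s\<close>, \<open>b = 2 * s\<close>,
  \<open>P = 0\<close>, with weight 3. The negative term in \<open>s * z\<close> dominates the
  deviations, so the single tangent at 3 is enough.\<close>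

lemma cost_two_large_parts:
  fixes s c q b P :: real
  assumes s: "(1647 / 3125) \<le> s" "s \<le> (10541 / 20000)" "s\<^sup>2 = 5 / 18"
    and c: "s / 2 \<le> c" "c \<le> s" and q: "2 / 5 \<le> q" "q \<le> s" and b: "2 / 5 \<le> b" "b \<le> 2 * s"
    and P: "b - c - q \<le> P" "0 \<le> P"
  shows "1 + c\<^sup>2 + q\<^sup>2 + b\<^sup>2 + 2 / 5 * P \<le> 11 / 5 * s * (c + q + b + P) + 2 / (3 * (3 + 5 / 2 * P))"
proof -
  define u where "u = s - c"
  define v where "v = s - q"
  define z where "z = 2 * s - b"
  have u: "0 \<le> u" "u \<le> (26353 / 100000)" and v: "0 \<le> v" "v \<le> (2541 / 20000)"
    and z: "0 \<le> z" "z \<le> (6541 / 10000)" and P': "u + v \<le> P + z"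
    using c q b s P by (auto simp: u_def v_def z_def)
  define R where "R = 2 / (3 * (3 + 5 / 2 * P))"
  have t: "2 / 9 - (18519 / 100000) * P \<le> R"
  proof -
    have "4 / (3 * 3) - 2 * (3 + 5 / 2 * P) / (3 * 3\<^sup>2) \<le> R"
      unfolding R_def using P by (intro reciprocal_tangent) auto
    then show ?thesis using P by (simp add: power2_eq_square field_simps)
  qed
  have sP: "(1647 / 3125) * P \<le> s * P" using s P by (intro mult_right_mono) auto
  have lhs: "1 + c\<^sup>2 + q\<^sup>2 + b\<^sup>2 + 2 / 5 * P - 11 / 5 * s * (c + q + b + P)
      = 2 / 9 + s / 5 * (u + v) + u\<^sup>2 + v\<^sup>2 - 9 / 5 * (s * z) + z\<^sup>2 + 2 / 5 * P - 11 / 5 * (s * P)"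
    using s(3) unfolding u_def v_def z_def by algebra
  have suv: "s / 5 * (u + v) \<le> (10541 / 100000) * (u + v)" using s u v by (intro mult_right_mono) auto
  have sz: "(1647 / 3125) * z \<le> s * z" using s z by (intro mult_right_mono) auto
  have sq: "u\<^sup>2 \<le> (26353 / 100000) * u" "v\<^sup>2 \<le> (2541 / 20000) * v"
    using u v by - (rule square_le_mult; linarith)+
  define T where "T = s / 5 * (u + v)"
  define Y where "Y = s * z"
  note suv = suv[folded T_def] and sz = sz[folded Y_def] and lhs = lhs[folded T_def Y_def]
  have "T + u\<^sup>2 + v\<^sup>2 - 9 / 5 * Y + z\<^sup>2 \<le> (287 / 500) * P"
  proof (cases "z \<le> (1 / 2)")
    case True
    then have "z\<^sup>2 \<le> (1 / 2) * z" using z by - (rule square_le_mult; linarith)+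
    then show ?thesis using suv sz sq u v z P P' by argo
  next
    case False
    then have "0 \<le> (z - (1 / 2)) * ((6541 / 10000) - z)" using z by (intro mult_nonneg_nonneg) auto
    then have "z\<^sup>2 \<le> (11541 / 10000) * z - (6541 / 20000)" by (simp add: power2_eq_square field_simps)
    then show ?thesis using suv sz sq u v z P P' by argo
  qed
  then show ?thesis using lhs t sP P unfolding R_def[symmetric] by linarith
qed

context separable_arcs
begin

lemma bounded_cong: "bounded W r c \<Longrightarrow> r = r' \<Longrightarrow> c = c' \<Longrightarrow> bounded W r' c'"
  by simp

lemma bounded_attach_small:
  assumes sp: "splits W A B" and A: "bounded A r c" "0 < r" and t: "0 < t" "t * ex B \<le> 1"
  shows "bounded W (r + t * ex B) (c + ex B / t)"
proof -
  have b: "0 < ex B" using splits_excess[OF sp] by simp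
  have "(ex B)\<^sup>2 / (t * ex B) = ex B / t" using b t by (simp add: power2_eq_square)
  then show ?thesis using bounded_attach[OF sp A, of "t * ex B"] b t by simp
qed

text \<open>The induction follows the larger part, which keeps size above
  \<open>\<sigma> / 2\<close> as long as the whole exceeds \<sigma>; the core is where it stops. The
  weights \<open>5 / 2 * p\<close> and 1 agree at \<open>p = 2 / 5\<close>.\<close>

lemma core_and_parts:
  assumes s: "(1647 / 3125) \<le> \<sigma>" "\<sigma> \<le> (10541 / 20000)"
  shows "W \<subseteq> V \<Longrightarrow> \<sigma> / 2 \<le> ex W \<Longrightarrow> ex W < 2 * \<sigma> \<Longrightarrow>
    (\<exists>c P. \<sigma> / 2 \<le> c \<and> c \<le> \<sigma> \<and> 0 \<le> P \<and> ex W = c + P \<and>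
       bounded W (1 + 5 / 2 * P) (1 + c\<^sup>2 + 2 / 5 * P)) \<or>
    (\<exists>c q P. \<sigma> / 2 \<le> c \<and> c \<le> \<sigma> \<and> 2 / 5 \<le> q \<and> q \<le> \<sigma> \<and> 0 \<le> P \<and> ex W = c + q + P \<and>
       bounded W (2 + 5 / 2 * P) (1 + c\<^sup>2 + q\<^sup>2 + 2 / 5 * P))"
proof (induction "card W" arbitrary: W rule: less_induct)
  case less
  show ?case
  proof (cases "ex W \<le> \<sigma>")
    case True
    then show ?thesis using bounded_leaf[OF less.prems(1)] less.prems(2)
      by - (rule disjI1, rule exI[of _ "ex W"], rule exI[of _ 0], auto)
  next
    case False
    then have "\<sigma> < ex W" by simp
    then obtain A B where sp: "splits W A B" and AB: "ex B \<le> ex A"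
      by (rule splits_exists[OF less.prems(1)])
    note fin = splits_finite[OF sp] and sz = splits_excess[OF sp]
    have IH: "(\<exists>c P. \<sigma> / 2 \<le> c \<and> c \<le> \<sigma> \<and> 0 \<le> P \<and> ex A = c + P \<and>
         bounded A (1 + 5 / 2 * P) (1 + c\<^sup>2 + 2 / 5 * P)) \<or>
      (\<exists>c q P. \<sigma> / 2 \<le> c \<and> c \<le> \<sigma> \<and> 2 / 5 \<le> q \<and> q \<le> \<sigma> \<and> 0 \<le> P \<and> ex A = c + q + P \<and>
         bounded A (2 + 5 / 2 * P) (1 + c\<^sup>2 + q\<^sup>2 + 2 / 5 * P))"
      using less.prems sz AB False fin by (intro less.hyps) auto
    have b: "0 < ex B" "ex B \<le> \<sigma>" using less.prems sz AB by auto
    from IH show ?thesis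
    proof (elim disjE exE conjE)
      fix c P
      assume c: "\<sigma> / 2 \<le> c" "c \<le> \<sigma>" "0 \<le> P" "ex A = c + P"
        and A: "bounded A (1 + 5 / 2 * P) (1 + c\<^sup>2 + 2 / 5 * P)"
      show ?thesis
      proof (cases "ex B \<le> 2 / 5")
        case True
        then have "bounded W (1 + 5 / 2 * P + 5 / 2 * ex B) (1 + c\<^sup>2 + 2 / 5 * P + ex B / (5 / 2))"
          using c by (intro bounded_attach_small[OF sp A]) auto
        then have "bounded W (1 + 5 / 2 * (P + ex B)) (1 + c\<^sup>2 + 2 / 5 * (P + ex B))"
          by (rule bounded_cong) (auto simp: field_simps)
        then show ?thesis using c b sz(1)
          by - (rule disjI1, rule exI[of _ c], rule exI[of _ "P + ex B"], auto)
      next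
        case False
        have "bounded W (1 + 5 / 2 * P + 1) (1 + c\<^sup>2 + 2 / 5 * P + (ex B)\<^sup>2 / 1)"
          using c by (intro bounded_attach[OF sp A]) auto
        then have "bounded W (2 + 5 / 2 * P) (1 + c\<^sup>2 + (ex B)\<^sup>2 + 2 / 5 * P)"
          by (rule bounded_cong) (auto simp: field_simps)
        then show ?thesis using c b sz(1) False
          by - (rule disjI2, rule exI[of _ c], rule exI[of _ "ex B"], rule exI[of _ P], auto)
      qed
    next
      fix c q P
      assume c: "\<sigma> / 2 \<le> c" "c \<le> \<sigma>" "2 / 5 \<le> q" "q \<le> \<sigma>" "0 \<le> P" "ex A = c + q + P"
        and A: "bounded A (2 + 5 / 2 * P) (1 + c\<^sup>2 + q\<^sup>2 + 2 / 5 * P)"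
      \<comment> \<open>Core and large part together take at least
        \<open>\<sigma> / 2 + 2 / 5\<close> of a total below \<open>2 * \<sigma>\<close>, which
        leaves less than \<open>2 / 5\<close>.\<close>
      have small: "ex B \<le> 2 / 5" using c less.prems sz(1) s by linarith
      then have "bounded W (2 + 5 / 2 * P + 5 / 2 * ex B) (1 + c\<^sup>2 + q\<^sup>2 + 2 / 5 * P + ex B / (5 / 2))"
        using c by (intro bounded_attach_small[OF sp A]) auto
      then have "bounded W (2 + 5 / 2 * (P + ex B)) (1 + c\<^sup>2 + q\<^sup>2 + 2 / 5 * (P + ex B))"
        by (rule bounded_cong) (auto simp: field_simps)
      then show ?thesis using c b sz(1)
        by - (rule disjI2, rule exI[of _ c], rule exI[of _ q], rule exI[of _ "P + ex B"], auto)
    qed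
  qed
qed

lemma good_middle_separability:
  assumes \<sigma>: "\<sigma>\<^sup>2 = 5 / 18" "0 < \<sigma>" and W: "W \<subseteq> V" "2 * \<sigma> \<le> ex W"
  shows "\<exists>r\<ge>2. good (11 / 5 * \<sigma>) W r"
proof -
  \<comment> \<open>A rational enclosure of \<open>sqrt 10 / 6\<close> to five digits, for linear
    arithmetic.\<close>
  have s: "(1647 / 3125) \<le> \<sigma>" "\<sigma> \<le> (10541 / 20000)"
    using \<sigma> by (auto intro: power2_le_imp_le simp: power_divide)
  show ?thesis
  proof (rule good_induct[where \<gamma> = "2 * \<sigma>"])
    fix U assume "2 * \<sigma> \<le> ex U" "ex U \<le> \<sigma>"
    then show "\<exists>r\<ge>2. good (11 / 5 * \<sigma>) U r" using \<sigma> by auto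
  next
    fix U A B assume sp: "splits U A B" and U: "2 * \<sigma> \<le> ex U" and AB: "ex B \<le> ex A" "ex A < 2 * \<sigma>"
    note sz = splits_excess[OF sp] and fin = splits_finite[OF sp]
    have a: "\<sigma> / 2 \<le> ex A" using U AB sz \<sigma>(2) by linarith
    from core_and_parts[OF s fin(4) a AB(2)]
    show "\<exists>r\<ge>2. good (11 / 5 * \<sigma>) U r"
    proof (elim disjE exE conjE)
      fix c P
      assume c: "\<sigma> / 2 \<le> c" "c \<le> \<sigma>" "0 \<le> P" "ex A = c + P"
        and A: "bounded A (1 + 5 / 2 * P) (1 + c\<^sup>2 + 2 / 5 * P)"
      show ?thesis
      proof (cases "ex B \<le> 2 / 5")
        case True
        let ?P = "P + ex B"
        have "bounded U (1 + 5 / 2 * P + 5 / 2 * ex B) (1 + c\<^sup>2 + 2 / 5 * P + ex B / (5 / 2))"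
          using c True by (intro bounded_attach_small[OF sp A]) auto
        then have "bounded U (1 + 5 / 2 * ?P) (1 + c\<^sup>2 + 2 / 5 * ?P)"
          by (rule bounded_cong) (auto simp: field_simps)
        moreover have "1 + c\<^sup>2 + 2 / 5 * ?P \<le> 11 / 5 * \<sigma> * (c + ?P) + 2 / (3 * (1 + 5 / 2 * ?P))"
          using c U sz by (intro cost_no_large_part[OF s \<sigma>(1)]) auto
        moreover have "c + ?P = ex U" using c sz(1) by simp
        ultimately have "good (11 / 5 * \<sigma>) U (1 + 5 / 2 * ?P)"
          using c sz(3) by (intro goodI[of U "1 + 5 / 2 * ?P"]) (auto intro: add_pos_nonneg)
        moreover have "2 \<le> 1 + 5 / 2 * ?P" using c U sz(1) s by argo
        ultimately show ?thesis by blast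
      next
        case False
        have "bounded U (1 + 5 / 2 * P + 1) (1 + c\<^sup>2 + 2 / 5 * P + (ex B)\<^sup>2 / 1)"
          using c by (intro bounded_attach[OF sp A]) auto
        then have "bounded U (2 + 5 / 2 * P) (1 + c\<^sup>2 + (ex B)\<^sup>2 + 2 / 5 * P)"
          by (rule bounded_cong) auto
        moreover have "1 + c\<^sup>2 + (ex B)\<^sup>2 + 2 / 5 * P \<le> 11 / 5 * \<sigma> * (c + ex B + P) + 2 / (3 * (2 + 5 / 2 * P))"
          using c U sz(1) False AB by (intro cost_one_large_part[OF s \<sigma>(1)]) auto
        moreover have "c + ex B + P = ex U" using c sz(1) by simp
        ultimately have "good (11 / 5 * \<sigma>) U (2 + 5 / 2 * P)"
          using c by (intro goodI[of U "2 + 5 / 2 * P"]) auto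
        then show ?thesis using c by (intro exI[of _ "2 + 5 / 2 * P"]) auto
      qed
    next
      fix c q P
      assume c: "\<sigma> / 2 \<le> c" "c \<le> \<sigma>" "2 / 5 \<le> q" "q \<le> \<sigma>" "0 \<le> P" "ex A = c + q + P"
        and A: "bounded A (2 + 5 / 2 * P) (1 + c\<^sup>2 + q\<^sup>2 + 2 / 5 * P)"
      show ?thesis
      proof (cases "ex B \<le> 2 / 5")
        case True
        let ?P = "P + ex B"
        have "bounded U (2 + 5 / 2 * P + 5 / 2 * ex B) (1 + c\<^sup>2 + q\<^sup>2 + 2 / 5 * P + ex B / (5 / 2))"
          using c True by (intro bounded_attach_small[OF sp A]) auto
        then have "bounded U (2 + 5 / 2 * ?P) (1 + c\<^sup>2 + q\<^sup>2 + 2 / 5 * ?P)"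
          by (rule bounded_cong) (auto simp: field_simps)
        moreover have "1 + c\<^sup>2 + q\<^sup>2 + 2 / 5 * ?P \<le> 11 / 5 * \<sigma> * (c + q + ?P) + 2 / (3 * (2 + 5 / 2 * ?P))"
          using c U sz \<sigma>(2) by (intro cost_one_large_part[OF s \<sigma>(1)]) auto
        moreover have "c + q + ?P = ex U" using c sz(1) by simp
        ultimately have "good (11 / 5 * \<sigma>) U (2 + 5 / 2 * ?P)"
          using c sz(3) by (intro goodI[of U "2 + 5 / 2 * ?P"]) (auto intro: add_pos_nonneg)
        then show ?thesis using c sz by (intro exI[of _ "2 + 5 / 2 * ?P"]) auto
      next
        case False
        have "bounded U (2 + 5 / 2 * P + 1) (1 + c\<^sup>2 + q\<^sup>2 + 2 / 5 * P + (ex B)\<^sup>2 / 1)"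
          using c by (intro bounded_attach[OF sp A]) auto
        then have "bounded U (3 + 5 / 2 * P) (1 + c\<^sup>2 + q\<^sup>2 + (ex B)\<^sup>2 + 2 / 5 * P)"
          by (rule bounded_cong) auto
        moreover have "1 + c\<^sup>2 + q\<^sup>2 + (ex B)\<^sup>2 + 2 / 5 * P
            \<le> 11 / 5 * \<sigma> * (c + q + ex B + P) + 2 / (3 * (3 + 5 / 2 * P))"
          using c U sz(1) False AB by (intro cost_two_large_parts[OF s \<sigma>(1)]) auto
        moreover have "c + q + ex B + P = ex U" using c sz(1) by simp
        ultimately have "good (11 / 5 * \<sigma>) U (3 + 5 / 2 * P)"
          using c by (intro goodI[of U "3 + 5 / 2 * P"]) auto
        then show ?thesis using c by (intro exI[of _ "3 + 5 / 2 * P"]) auto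
      qed
    qed
  next
    fix U A B r assume sp: "splits U A B" and B: "ex B < 2 * \<sigma>" and A: "good (11 / 5 * \<sigma>) A r" "2 \<le> r"
    have b: "0 < ex B" using splits_excess[OF sp] by simp
    show "\<exists>r'\<ge>2. good (11 / 5 * \<sigma>) U r'"
    proof (cases "ex B \<le> \<sigma> / 5")
      case True
      let ?t = "5 / 2 * ex B"
      have "(ex B)\<^sup>2 / ?t = 2 / 5 * ex B" using b by (simp add: power2_eq_square)
      moreover have "?t / (2 * (2 + ?t)) \<le> ?t / 4" using b by (intro divide_left_mono) auto
      moreover have "(1647 / 3125) * ex B \<le> \<sigma> * ex B" using s b by (intro mult_right_mono) auto
      ultimately have "(ex B)\<^sup>2 / ?t + 2 / 3 * (?t / (2 * (2 + ?t))) \<le> 11 / 5 * \<sigma> * ex B"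
        using b by linarith
      then have "good (11 / 5 * \<sigma>) U (r + ?t)"
        using b True s A by (intro good_attach[OF sp, where \<rho> = 2]) auto
      then show ?thesis using A b by (intro exI[of _ "r + ?t"]) auto
    next
      case False
      \<comment> \<open>With weight 1 the cost is \<open>b\<^sup>2 + 1 / 9\<close>, and
        \<open>1 / 9 = (\<sigma> / 5) * (2 * \<sigma>)\<close>. The slope
        \<open>11 / 5 * \<sigma>\<close> is the sum of these two roots, so attaching is sharp as the
        part approaches size \<open>2 * \<sigma>\<close>.\<close>
      then have "(ex B - \<sigma> / 5) * (ex B - 2 * \<sigma>) \<le> 0" using B by (intro mult_nonneg_nonpos) auto
      then have "(ex B)\<^sup>2 / 1 + 2 / 3 * (1 / (2 * (2 + 1))) \<le> 11 / 5 * \<sigma> * ex B"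
        using \<sigma>(1) by (simp add: power2_eq_square algebra_simps)
      then have "good (11 / 5 * \<sigma>) U (r + 1)"
        using A by (intro good_attach[OF sp, where \<rho> = 2]) auto
      then show ?thesis using A by (intro exI[of _ "r + 1"]) auto
    qed
  qed (use W in auto)
qed

end

section \<open>A logarithmic potential\<close>

text \<open>The rational function is the Pade approximant of first order; the difference of the two
  sides has derivative \<open>t\<^sup>2 / ((a + t) * (2 * a + t)\<^sup>2)\<close>.\<close>

lemma ln_add_ge:
  fixes a b :: real
  assumes a: "0 < a" and b: "0 \<le> b"
  shows "ln a + 2 * b / (2 * a + b) \<le> ln (a + b)"
proof -
  define f where "f t = ln (a + t) - 2 * t / (2 * a + t)" for t
  have "f 0 \<le> f b"
  proof (rule DERIV_nonneg_imp_nondecreasing[OF b])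
    fix t :: real assume t: "0 \<le> t" "t \<le> b"
    have "((\<lambda>t. ln (a + t)) has_real_derivative 1 / (a + t)) (at t)"
      using a t by (auto intro!: derivative_eq_intros)
    moreover have "((\<lambda>t. 2 * t / (2 * a + t)) has_real_derivative 4 * a / (2 * a + t)\<^sup>2) (at t)"
      using a t by (auto intro!: derivative_eq_intros simp: power2_eq_square)
    ultimately have "(f has_real_derivative (1 / (a + t) - 4 * a / (2 * a + t)\<^sup>2)) (at t)"
      unfolding f_def by (rule DERIV_diff)
    moreover have "0 \<le> 1 / (a + t) - 4 * a / (2 * a + t)\<^sup>2"
    proof -
      have "1 / (a + t) - 4 * a / (2 * a + t)\<^sup>2 = t\<^sup>2 / ((a + t) * (2 * a + t)\<^sup>2)"
        using a t by (simp add: divide_simps) (simp add: power2_eq_square algebra_simps)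
      then show ?thesis using a t by simp
    qed
    ultimately show "\<exists>y. (f has_real_derivative y) (at t) \<and> 0 \<le> y" by blast
  qed
  then show ?thesis unfolding f_def by simp
qed

lemma ln_chord_le:
  fixes u v a :: real
  assumes "0 < u" "u \<le> a" "a \<le> v"
  shows "(v - a) * ln u + (a - u) * ln v \<le> (v - u) * ln a"
proof -
  have a: "0 < a" "0 < v" using assms by auto
  have t: "ln x \<le> ln a + (x - a) / a" if "0 < x" for x
  proof -
    have "ln (x / a) \<le> x / a - 1" using that a by (intro ln_le_minus_one) auto
    then show ?thesis using that a by (simp add: ln_div diff_divide_distrib)
  qed
  have "(v - a) * ln u + (a - u) * ln v
      \<le> (v - a) * (ln a + (u - a) / a) + (a - u) * (ln a + (v - a) / a)"
    using t[OF assms(1)] t[OF a(2)] assms by (intro add_mono mult_left_mono) auto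
  also have "\<dots> = (v - u) * ln a" using a by (simp add: divide_simps) (simp add: algebra_simps)
  finally show ?thesis .
qed

text \<open>
  For a fixed price \<open>\<mu>\<^sup>2\<close> per unit of \<open>r\<close>, the cost \<open>b\<^sup>2 / s + \<mu>\<^sup>2 s\<close> of a part is smallest at \<open>s = b / \<mu>\<close>,
  or at \<open>s = 1\<close> if \<open>b > \<mu>\<close>.
\<close>

definition piece_cost :: "real \<Rightarrow> real \<Rightarrow> real" where
  "piece_cost \<mu> b = (if b \<le> \<mu> then 2 * \<mu> * b else b\<^sup>2 + \<mu>\<^sup>2)"

text \<open>
  The costs add up fastest when each new part is as large as the whole before it. Doubling from \<open>a\<close> to
  \<open>2 a\<close> costs \<open>a\<^sup>2 + \<mu>\<^sup>2\<close>, which is the growth of \<open>g\<^sup>2 / 3 + \<mu>\<^sup>2 log\<^sub>2 g\<close>. With the factor \<open>3 / 2\<close> in place of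
  \<open>1 / ln 2\<close>, the step for a small part becomes the inequality between arithmetic and geometric mean.
\<close>

definition potential :: "real \<Rightarrow> real \<Rightarrow> real \<Rightarrow> real" where
  "potential \<mu> K g = K + g\<^sup>2 / 3 + 3 / 2 * \<mu>\<^sup>2 * ln g"

text \<open>With \<open>n = 2 * a + b\<close> the quadratic term grows by \<open>b * n / 3\<close>
  and the logarithmic one by at least \<open>3 * \<mu>\<^sup>2 * b / n\<close>. Their product is
  \<open>(\<mu> * b)\<^sup>2\<close>, so their sum is at least \<open>2 * \<mu> * b\<close>. For
  \<open>b > \<mu>\<close> the surplus has the factor \<open>n - 3 * b\<close>, which is nonnegative
  because \<open>b \<le> a\<close>.\<close>

lemma potential_add_piece:
  assumes \<mu>: "0 < \<mu>" and b: "0 < b" "b \<le> a"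
  shows "potential \<mu> K a + piece_cost \<mu> b \<le> potential \<mu> K (a + b)"
proof -
  define n where "n = 2 * a + b"
  have n: "0 < n" "3 * b \<le> n" using b by (auto simp: n_def)
  have "ln a + 2 * b / n \<le> ln (a + b)" unfolding n_def using b by (intro ln_add_ge) auto
  then have "3 / 2 * \<mu>\<^sup>2 * (ln a + 2 * b / n) \<le> 3 / 2 * \<mu>\<^sup>2 * ln (a + b)"
    by (intro mult_left_mono) auto
  moreover have "3 / 2 * \<mu>\<^sup>2 * (ln a + 2 * b / n) = 3 / 2 * \<mu>\<^sup>2 * ln a + 3 * \<mu>\<^sup>2 * b / n"
    by (simp add: distrib_left)
  ultimately have "3 / 2 * \<mu>\<^sup>2 * ln a + 3 * \<mu>\<^sup>2 * b / n \<le> 3 / 2 * \<mu>\<^sup>2 * ln (a + b)"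
    by simp
  moreover have "(a + b)\<^sup>2 / 3 = a\<^sup>2 / 3 + b * n / 3"
    unfolding n_def by (simp add: power2_eq_square algebra_simps)
  moreover have "piece_cost \<mu> b \<le> b * n / 3 + 3 * \<mu>\<^sup>2 * b / n"
  proof (cases "b \<le> \<mu>")
    case True
    have "b * n / 3 + 3 * \<mu>\<^sup>2 * b / n - 2 * \<mu> * b = b * (n - 3 * \<mu>)\<^sup>2 / (3 * n)"
      using n by (simp add: divide_simps) (simp add: power2_eq_square algebra_simps)
    moreover have "0 \<le> b * (n - 3 * \<mu>)\<^sup>2 / (3 * n)" using b n by simp
    ultimately show ?thesis using True unfolding piece_cost_def by simp
  next
    case False
    have "\<mu> * \<mu> * 3 \<le> b * n"
    proof -
      have "\<mu> * (3 * \<mu>) \<le> b * n" using False \<mu> n by (intro mult_mono) auto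
      then show ?thesis by simp
    qed
    then have "0 \<le> (n - 3 * b) * (b * n - 3 * \<mu>\<^sup>2) / (3 * n)"
      using n by (intro divide_nonneg_pos mult_nonneg_nonneg) (auto simp: power2_eq_square)
    moreover have "b * n / 3 + 3 * \<mu>\<^sup>2 * b / n - (b\<^sup>2 + \<mu>\<^sup>2) = (n - 3 * b) * (b * n - 3 * \<mu>\<^sup>2) / (3 * n)"
      using n by (simp add: divide_simps) (simp add: power2_eq_square algebra_simps)
    ultimately show ?thesis using False unfolding piece_cost_def by simp
  qed
  ultimately show ?thesis unfolding potential_def by linarith
qed

context separable_arcs
begin

lemma bounded_attach_piece:
  assumes sp: "splits W A B" and A: "bounded A r c" "0 < r" and \<mu>: "0 < \<mu>"
  defines "s \<equiv> min (ex B / \<mu>) 1"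
  shows "\<exists>d. bounded W (r + s) d \<and> d + \<mu>\<^sup>2 * (r + s) \<le> c + \<mu>\<^sup>2 * r + piece_cost \<mu> (ex B)"
proof -
  have b: "0 < ex B" using splits_excess[OF sp] by simp
  have s: "0 < s" "s \<le> 1" using b \<mu> unfolding s_def by auto
  have "(ex B)\<^sup>2 / s + \<mu>\<^sup>2 * s = piece_cost \<mu> (ex B)"
  proof (cases "ex B \<le> \<mu>")
    case True
    then have "s = ex B / \<mu>" using \<mu> unfolding s_def by (auto simp: min_def divide_simps)
    then show ?thesis using True b \<mu> unfolding piece_cost_def
      by (simp add: power2_eq_square)
  next
    case False
    then have "s = 1" using \<mu> unfolding s_def by (auto simp: min_def divide_simps)
    then show ?thesis using False unfolding piece_cost_def by simp
  qed
  then show ?thesis using bounded_attach[OF sp A s]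
    by (intro exI[of _ "c + (ex B)\<^sup>2 / s"]) (auto simp: algebra_simps)
qed

text \<open>The hypothesis \<open>leaf\<close> treats the separation at which the size passes
  \<open>T\<close>; above it each part is paid by the growth of the potential. The lower bound on
  \<open>r\<close> matters because the potential controls only \<open>c + \<mu>\<^sup>2 * r\<close>,
  while the claim also requires a minimal weight.\<close>

lemma bounded_potential:
  assumes \<mu>: "0 < \<mu>" and T: "0 < T" "\<sigma> \<le> T" and \<nu>: "0 \<le> \<nu>" "\<nu> * \<mu> \<le> T" "\<nu> * ln 2 \<le> 1"
    and leaf: "\<And>a b. T / 2 \<le> a \<Longrightarrow> a \<le> T \<Longrightarrow> 0 < b \<Longrightarrow> b \<le> a \<Longrightarrow> T < a + b \<Longrightarrow>
      1 + \<mu>\<^sup>2 + a\<^sup>2 + piece_cost \<mu> b \<le> potential \<mu> K (a + b)"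
  shows "W \<subseteq> V \<Longrightarrow> T < ex W \<Longrightarrow>
    \<exists>r c. bounded W r c \<and> 1 + \<nu> * ln (ex W / T) \<le> r \<and> c + \<mu>\<^sup>2 * r \<le> potential \<mu> K (ex W)"
proof (induction "card W" arbitrary: W rule: less_induct)
  case less
  then have "\<sigma> < ex W" using T by simp
  then obtain A B where sp: "splits W A B" and AB: "ex B \<le> ex A"
    by (rule splits_exists[OF less.prems(1)])
  note fin = splits_finite[OF sp] and sz = splits_excess[OF sp]
  have "\<exists>r c. bounded A r c \<and> 1 + \<nu> * ln (max (ex A) T / T) \<le> r \<and>
      c + \<mu>\<^sup>2 * r + piece_cost \<mu> (ex B) \<le> potential \<mu> K (ex W)"
  proof (cases "ex A \<le> T")
    case True
    then have "1 + \<mu>\<^sup>2 + (ex A)\<^sup>2 + piece_cost \<mu> (ex B) \<le> potential \<mu> K (ex W)"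
      using leaf[of "ex A" "ex B"] AB sz less.prems by simp
    then show ?thesis using bounded_leaf[OF fin(4)] True T
      by (intro exI[of _ 1] exI[of _ "1 + (ex A)\<^sup>2"]) (auto simp: max_def)
  next
    case False
    then obtain r c where rc: "bounded A r c" "1 + \<nu> * ln (ex A / T) \<le> r" "c + \<mu>\<^sup>2 * r \<le> potential \<mu> K (ex A)"
      using less.hyps[OF sz(4) fin(4)] by auto
    then have "c + \<mu>\<^sup>2 * r + piece_cost \<mu> (ex B) \<le> potential \<mu> K (ex W)"
      using potential_add_piece[OF \<mu> sz(3) AB, of K] sz(1) by simp
    then show ?thesis using rc False by (intro exI[of _ r] exI[of _ c]) (auto simp: max_def)
  qed
  then obtain r c where rc: "bounded A r c" "1 + \<nu> * ln (max (ex A) T / T) \<le> r"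
      "c + \<mu>\<^sup>2 * r + piece_cost \<mu> (ex B) \<le> potential \<mu> K (ex W)" by blast
  have "0 \<le> ln (max (ex A) T / T)" using T by (intro ln_ge_zero) (auto simp: max_def divide_simps)
  then have r: "0 < r" using rc(2) \<nu>(1) by (smt (verit) mult_nonneg_nonneg)
  define m where "m = max (ex A) T"
  have m: "0 < m" "T \<le> m" "ex A \<le> m" using T unfolding m_def by auto
  have W: "0 < ex W" using less.prems T by simp
  \<comment> \<open>The growth of the logarithm is at most \<open>ex B / T\<close> and, as the
    larger part is kept, at most \<open>ln 2\<close>. The two conditions on \<nu> compare these with
    \<open>ex B / \<mu>\<close> and 1.\<close>
  have "\<nu> * ln (ex W / m) \<le> min (ex B / \<mu>) 1"
  proof -
    have "ln (ex W / m) \<le> ex W / m - 1" using W m by (intro ln_le_minus_one) auto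
    also have "\<dots> \<le> ex B / T"
    proof -
      have "ex W / m - 1 \<le> ex B / m" using m sz(1) by (simp add: divide_simps)
      also have "\<dots> \<le> ex B / T" using m T sz by (intro divide_left_mono) auto
      finally show ?thesis .
    qed
    finally have "\<nu> * ln (ex W / m) \<le> \<nu> * (ex B / T)" using \<nu> by (intro mult_left_mono) auto
    also have "\<dots> \<le> ex B / \<mu>"
    proof -
      have "\<nu> * \<mu> * ex B \<le> T * ex B" using \<nu> sz by (intro mult_right_mono) auto
      then show ?thesis using T \<mu> by (simp add: divide_simps mult.commute mult.left_commute)
    qed
    finally have 1: "\<nu> * ln (ex W / m) \<le> ex B / \<mu>" .
    have "ln (ex W / m) \<le> ln 2" using W m AB sz(1) by (subst ln_le_cancel_iff) (auto simp: divide_simps)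
    then have "\<nu> * ln (ex W / m) \<le> \<nu> * ln 2" using \<nu> by (intro mult_left_mono) auto
    with 1 \<nu> show ?thesis by simp
  qed
  moreover have "ln (ex W / T) = ln (ex W / m) + ln (m / T)"
    using W m T by (simp add: ln_div)
  then have "\<nu> * ln (ex W / T) = \<nu> * ln (ex W / m) + \<nu> * ln (m / T)"
    by (simp add: distrib_left)
  ultimately have "1 + \<nu> * ln (ex W / T) \<le> r + min (ex B / \<mu>) 1"
    using rc(2) unfolding m_def[symmetric] by linarith
  moreover obtain d where "bounded W (r + min (ex B / \<mu>) 1) d"
      "d + \<mu>\<^sup>2 * (r + min (ex B / \<mu>) 1) \<le> c + \<mu>\<^sup>2 * r + piece_cost \<mu> (ex B)"
    using bounded_attach_piece[OF sp rc(1) r \<mu>] by blast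
  ultimately show ?case using rc(3) by (meson order_trans)
qed

end

section \<open>Numerical estimates for the potential\<close>

lemma piece_cost_leaf:
  assumes "0 < \<mu>" "0 < b" "b \<le> a" and "1 + \<mu>\<^sup>2 + a\<^sup>2 \<le> potential \<mu> K a"
  shows "1 + \<mu>\<^sup>2 + a\<^sup>2 + piece_cost \<mu> b \<le> potential \<mu> K (a + b)"
  using potential_add_piece[OF assms(1-3), of K] assms(4) by linarith

lemma convex_quadratic_le:
  fixes p q x u v :: real
  assumes "0 \<le> p" "u \<le> x" "x \<le> v"
    and "p * u\<^sup>2 + q * u \<le> C" "p * v\<^sup>2 + q * v \<le> C"
  shows "p * x\<^sup>2 + q * x \<le> C"
proof (cases "u = v")
  case False
  have "0 \<le> p * ((x - u) * (v - x))" using assms by (intro mult_nonneg_nonneg) auto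
  then have 1: "p * x\<^sup>2 \<le> p * ((u + v) * x) - p * (u * v)"
    by (simp add: power2_eq_square algebra_simps)
  have "(v - x) * (p * u\<^sup>2 + q * u) + (x - u) * (p * v\<^sup>2 + q * v) \<le> (v - x) * C + (x - u) * C"
    using assms by (intro add_mono mult_left_mono) auto
  moreover have "(v - x) * (p * u\<^sup>2 + q * u) + (x - u) * (p * v\<^sup>2 + q * v)
      = (v - u) * (p * ((u + v) * x) - p * (u * v) + q * x)"
    by (simp add: power2_eq_square algebra_simps)
  moreover have "(v - x) * C + (x - u) * C = (v - u) * C" by (simp add: algebra_simps)
  ultimately have "p * ((u + v) * x) - p * (u * v) + q * x \<le> C"
    using False assms(2,3) by (metis diff_gt_0_iff_gt less_eq_real_def mult_le_cancel_left_pos order_trans)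
  with 1 show ?thesis by linarith
qed (use assms in auto)

text \<open>Replacing the concave logarithm by its chord leaves a convex quadratic in
  \<open>a\<close>, for which the two ends of the interval suffice.\<close>

lemma leaf_below_potential:
  assumes a: "0 < u" "u < v" "u \<le> a" "a \<le> v"
    and u: "1 + \<mu>\<^sup>2 + 2 / 3 * u\<^sup>2 \<le> K + 3 / 2 * \<mu>\<^sup>2 * ln u"
    and v: "1 + \<mu>\<^sup>2 + 2 / 3 * v\<^sup>2 \<le> K + 3 / 2 * \<mu>\<^sup>2 * ln v"
  shows "1 + \<mu>\<^sup>2 + a\<^sup>2 \<le> potential \<mu> K a"
proof -
  define q where "q = 3 / 2 * \<mu>\<^sup>2 * (ln u - ln v) / (v - u)"
  define C where "C = K - 1 - \<mu>\<^sup>2 + 3 / 2 * \<mu>\<^sup>2 * ((v * ln u - u * ln v) / (v - u))"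
  have lin: "3 / 2 * \<mu>\<^sup>2 * (((v - x) * ln u + (x - u) * ln v) / (v - u)) = C - (K - 1 - \<mu>\<^sup>2) - q * x" for x
    unfolding q_def C_def using a(2) by (simp add: divide_simps) (simp add: algebra_simps)
  have "2 / 3 * a\<^sup>2 + q * a \<le> C"
  proof (rule convex_quadratic_le[OF _ a(3,4)])
    have "3 / 2 * \<mu>\<^sup>2 * ln u = C - (K - 1 - \<mu>\<^sup>2) - q * u" using lin[of u] a(2) by simp
    with u show "2 / 3 * u\<^sup>2 + q * u \<le> C" by linarith
    have "3 / 2 * \<mu>\<^sup>2 * ln v = C - (K - 1 - \<mu>\<^sup>2) - q * v" using lin[of v] a(2) by simp
    with v show "2 / 3 * v\<^sup>2 + q * v \<le> C" by linarith
  qed simp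
  moreover have "((v - a) * ln u + (a - u) * ln v) / (v - u) \<le> ln a"
    using ln_chord_le[OF a(1,3,4)] a(2) by (simp add: divide_simps mult.commute)
  then have "3 / 2 * \<mu>\<^sup>2 * (((v - a) * ln u + (a - u) * ln v) / (v - u)) \<le> 3 / 2 * \<mu>\<^sup>2 * ln a"
    by (intro mult_left_mono) auto
  ultimately show ?thesis using lin[of a] unfolding potential_def by linarith
qed

lemma ln_2_le: "ln 2 \<le> (697 / 1000 :: real)"
proof -
  \<comment> \<open>A quarter of the bound, so that the quadratic Taylor polynomial is accurate
    enough.\<close>
  define x :: real where "x = 697 / 4000"
  have "1 + x + x\<^sup>2 / 2 \<le> exp x"
    by (rule exp_lower_Taylor_quadratic) (simp add: x_def)
  then have "(118942 / 100000) \<le> exp x" by (simp add: x_def power_divide)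
  then have "(118942 / 100000) ^ 4 \<le> exp x ^ 4" by (intro power_mono) auto
  also have "exp x ^ 4 = exp (4 * x)" by (simp add: exp_of_nat_mult[of 4, symmetric])
  finally have "2 \<le> exp (4 * x)" by (simp add: power_divide)
  then have "ln 2 \<le> ln (exp (4 * x))" by (subst ln_le_cancel_iff) auto
  then show ?thesis by (simp add: x_def)
qed

lemma ln_lower_bounds:
  "- (1281 / 1000) \<le> ln (7 / 25 :: real)" "- (1763 / 1000) \<le> ln (7 / 40 :: real)"
  "- (2133 / 1000) \<le> ln (3 / 25 :: real)" "- (1436 / 1000) \<le> ln (6 / 25 :: real)"
proof -
  note l2 = ln_2_le
  have p: "ln (2 ^ n * x) = real n * ln 2 + ln x" if "0 < x" for x :: real and n
    using that by (simp add: ln_mult ln_realpow)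
  have "ln (28 / 25 :: real) \<ge> 6 / 53" using ln_add_ge[of 1 "3 / 25"] by simp
  moreover have "ln (28 / 25 :: real) = 2 * ln 2 + ln (7 / 25)" using p[of "7 / 25" 2] by simp
  ultimately show "- (1281 / 1000) \<le> ln (7 / 25 :: real)" using l2 by linarith
  have "ln (7 / 5 :: real) \<ge> 1 / 3" using ln_add_ge[of 1 "2 / 5"] by simp
  moreover have "ln (7 / 5 :: real) = 3 * ln 2 + ln (7 / 40)" using p[of "7 / 40" 3] by simp
  ultimately show "- (1763 / 1000) \<le> ln (7 / 40 :: real)" using l2 by linarith
  have e: "ln (24 / 25 :: real) \<ge> - (1 / 24)"
    using ln_le_minus_one[of "25 / 24 :: real"] ln_inverse[of "24 / 25 :: real"] by simp
  moreover have "ln (24 / 25 :: real) = 3 * ln 2 + ln (3 / 25)" using p[of "3 / 25" 3] by simp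
  ultimately show "- (2133 / 1000) \<le> ln (3 / 25 :: real)" using l2 by linarith
  have "ln (24 / 25 :: real) = 2 * ln 2 + ln (6 / 25)" using p[of "6 / 25" 2] by simp
  with e show "- (1436 / 1000) \<le> ln (6 / 25 :: real)" using l2 by linarith
qed

lemma potential_21: "potential (21 / 100) K g = K + g\<^sup>2 / 3 + 1323 / 20000 * ln g"
  by (simp add: potential_def power_divide)

lemma potential_17: "potential (17 / 100) K g = K + g\<^sup>2 / 3 + 867 / 20000 * ln g"
  by (simp add: potential_def power_divide)

text \<open>
  The constants for \<open>\<mu> = 21 / 100\<close> were found numerically and leave little room: less than \<open>1 / 1000\<close> here
  for \<open>a = 7 / 50\<close> and for \<open>a = 7 / 25\<close>, and later at \<open>g = 6 / 5\<close> and \<open>g = 2\<close>.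
\<close>

lemma leaf_bound_21:
  assumes a: "7 / 50 \<le> a" "a \<le> 7 / 25" and b: "0 < b" "b \<le> a" "7 / 25 < a + b"
  shows "1 + (21 / 100)\<^sup>2 + a\<^sup>2 + piece_cost (21 / 100) b \<le> potential (21 / 100) (11812 / 10000) (a + b)"
proof (cases "7 / 40 \<le> a")
  case True
  have "1 + (21 / 100)\<^sup>2 + a\<^sup>2 \<le> potential (21 / 100) (11812 / 10000) a"
    using ln_lower_bounds(1,2) True a
    by (intro leaf_below_potential[of "7 / 40" "7 / 25"]) (auto simp: power2_eq_square)
  then show ?thesis using b by (intro piece_cost_leaf) auto
next
  case False
  \<comment> \<open>For \<open>a = 7 / 50\<close> the inequality fails without the second part, so
    \<open>a + b > 7 / 25\<close> has to be used.\<close>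
  define s where "s = a + b"
  have s: "7 / 25 \<le> s" "s \<le> 7 / 20" "s / 2 \<le> a" using b False by (auto simp: s_def)
  \<comment> \<open>For a fixed sum the worst case is \<open>a = b\<close>.\<close>
  have "(a - s / 2) * (a + s / 2 - 42 / 100) \<le> 0"
    using s False by (intro mult_nonneg_nonpos) auto
  then have 1: "a\<^sup>2 - 42 / 100 * a \<le> s\<^sup>2 / 4 - 21 / 100 * s"
    by (simp add: power2_eq_square field_simps)
  define d where "d = s - 7 / 25"
  have d: "0 \<le> d" "14 / 25 + d \<le> 63 / 100" using s by (auto simp: d_def)
  define q where "q = 2 * d / (2 * (7 / 25) + d)"
  have "ln (7 / 25) + q \<le> ln (7 / 25 + d)"
    unfolding q_def using d by (intro ln_add_ge) auto
  moreover have "2 * d / (63 / 100) \<le> q"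
    unfolding q_def using d by (intro divide_left_mono) auto
  moreover have "7 / 25 + d = s" by (simp add: d_def)
  ultimately have "- (1281 / 1000) + 200 / 63 * d \<le> ln s"
    using ln_lower_bounds(1) by simp
  then have "200 / 63 * s - 8 / 9 - 1281 / 1000 \<le> ln s" by (simp add: d_def field_simps)
  moreover have "(7 / 25)\<^sup>2 \<le> s\<^sup>2" using s by (intro power_mono) auto
  then have "49 / 625 \<le> s\<^sup>2" by (simp add: power_divide)
  moreover have "piece_cost (21 / 100) b = 42 / 100 * s - 42 / 100 * a"
    using b False unfolding piece_cost_def s_def by (simp add: field_simps)
  moreover have "1 + (21 / 100)\<^sup>2 = (10441 / 10000 :: real)" by (simp add: power_divide)
  ultimately show ?thesis using 1 unfolding potential_21 s_def[symmetric] by linarith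
qed

lemma leaf_bound_17:
  assumes a: "3 / 25 \<le> a" "a \<le> 6 / 25" and b: "0 < b" "b \<le> a"
  shows "1 + (17 / 100)\<^sup>2 + a\<^sup>2 + piece_cost (17 / 100) b \<le> potential (17 / 100) (1131 / 1000) (a + b)"
proof -
  have "1 + (17 / 100)\<^sup>2 + a\<^sup>2 \<le> potential (17 / 100) (1131 / 1000) a"
    using ln_lower_bounds(3,4) a
    by (intro leaf_below_potential[of "3 / 25" "6 / 25"]) (auto simp: power2_eq_square)
  then show ?thesis using b by (intro piece_cost_leaf) auto
qed

text \<open>The intercept is \<open>12 / 35\<close> rounded down, the value of
  \<open>4 / (3 * a)\<close> at \<open>a = 35 / 9\<close>, where the slope of
  \<open>2 / (3 * r)\<close> is about \<open>- (21 / 100)\<^sup>2\<close>. Tangents of the logarithm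
  at \<open>6 / 5\<close> and 2 reduce the bound to convex quadratics.\<close>

lemma potential_21_le:
  assumes "6 / 5 \<le> g" "g \<le> 2"
  shows "potential (21 / 100) (11812 / 10000) g \<le> 1109 / 1000 * g + 3428 / 10000"
proof -
  have t: "ln g \<le> ln c + g / c - 1" if "0 < c" for c
    using ln_le_minus_one[of "g / c"] that assms by (simp add: ln_div)
  show ?thesis
  proof (cases "g \<le> 8 / 5")
    case True
    have "exp (1834 / 10000) \<ge> (6 / 5 :: real)"
      using exp_lower_Taylor_quadratic[of "1834 / 10000"] by (simp add: power2_eq_square)
    then have "ln (6 / 5 :: real) \<le> ln (exp (1834 / 10000))" by (subst ln_le_cancel_iff) auto
    with t[of "6 / 5"] have "ln g \<le> 1834 / 10000 + 5 / 6 * g - 1" by simp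
    moreover have "1 / 3 * g\<^sup>2 + - (8431 / 8000) * g \<le> - (7846 / 10000)"
      using assms True by - (rule convex_quadratic_le[of _ "6 / 5" _ "8 / 5"], auto simp: power2_eq_square)
    ultimately show ?thesis unfolding potential_21 by linarith
  next
    case False
    have "ln g \<le> 697 / 1000 + g / 2 - 1" using t[of 2] ln_2_le by simp
    moreover have "1 / 3 * g\<^sup>2 + - (43037 / 40000) * g \<le> - (8185 / 10000)"
      using assms False by - (rule convex_quadratic_le[of _ "8 / 5" _ 2], auto simp: power2_eq_square)
    ultimately show ?thesis unfolding potential_21 by linarith
  qed
qed

lemma potential_21_le_near_1:
  assumes "1 \<le> a" "a \<le> 6 / 5"
  shows "potential (21 / 100) (11812 / 10000) a \<le> 1109 / 1000 * a + 4056 / 10000"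
proof -
  have "ln a \<le> a - 1" using assms by (intro ln_le_minus_one) auto
  moreover have "1 / 3 * a\<^sup>2 + - (20857 / 20000) * a \<le> - (70950 / 100000)"
    using assms by - (rule convex_quadratic_le[of _ 1 _ "6 / 5"], auto simp: power2_eq_square)
  ultimately show ?thesis unfolding potential_21 by linarith
qed

lemma potential_17_le:
  assumes "1 \<le> a" "a \<le> 6 / 5"
  shows "potential (17 / 100) (1131 / 1000) a \<le> 777 / 1000 * a + 68734 / 100000"
proof -
  have "ln a \<le> a - 1" using assms by (intro ln_le_minus_one) auto
  moreover have "1 / 3 * a\<^sup>2 + - (14673 / 20000) * a \<le> - (400311 / 1000000)"
    using assms by - (rule convex_quadratic_le[of _ 1 _ "6 / 5"], auto simp: power2_eq_square)
  ultimately show ?thesis unfolding potential_17 by linarith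
qed

section \<open>Parts of size greater than 1\<close>

text \<open>
  Counting a part of size \<open>b > 1\<close> as a complete graph is too expensive when \<open>\<sigma> = 1 / 5\<close>, so such a part is
  separated further, keeping track of the forbidden set \<open>X\<close> (at first the separator) of size \<open>y\<close>.
  For the price \<open>(17 / 100)\<^sup>2\<close> per unit of \<open>r\<close>, the total cost is at most \<open>1 + (17 / 100)\<^sup>2\<close> plus a multiple of
  \<open>b - y\<close> instead of the \<open>b\<^sup>2 - y\<^sup>2\<close> of a complete graph. Below, \<open>x\<close> and \<open>z\<close> are the sizes of the
  parts of \<open>X\<close> in \<open>B - A\<close> and in \<open>A \<inter> B\<close>.
\<close>

definition forbidden_potential :: "real \<Rightarrow> real" where
  "forbidden_potential \<beta> = (if 0 \<le> \<beta> then 1346 / 1000 * \<beta> else 65 / 100 * \<beta>)"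

text \<open>The infimum of \<open>\<epsilon>\<^sup>2 * (1 / s - 1) + (17 / 100)\<^sup>2 * s\<close>
  over weights \<open>s\<close> in \<open>(0, 1]\<close>.\<close>

definition forbidden_cost :: "real \<Rightarrow> real" where
  "forbidden_cost \<epsilon> = (if \<epsilon> \<le> 17 / 100 then 34 / 100 * \<epsilon> - \<epsilon>\<^sup>2 else (17 / 100)\<^sup>2)"

text \<open>The slack \<open>\<eta>\<close> is needed for \<open>\<epsilon> = 0\<close>, where the best weight \<open>s = 0\<close> is not admissible.\<close>

lemma forbidden_cost_attained:
  assumes e: "0 \<le> \<epsilon>" and \<eta>: "0 < \<eta>"
  obtains s where "0 < s" "s \<le> 1"
    "\<epsilon>\<^sup>2 * (1 / s - 1) + (17 / 100)\<^sup>2 * s \<le> forbidden_cost \<epsilon> + \<eta>"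
proof (cases "\<epsilon> = 0")
  case True
  have "(17 / 100)\<^sup>2 * min 1 \<eta> \<le> 1 * \<eta>" using \<eta> by (intro mult_mono) (auto simp: power2_eq_square)
  then show ?thesis using True \<eta> by (intro that[of "min 1 \<eta>"]) (auto simp: forbidden_cost_def)
next
  case False
  show ?thesis
  proof (cases "\<epsilon> \<le> 17 / 100")
    case True
    have "\<epsilon>\<^sup>2 * (1 / (\<epsilon> / (17 / 100)) - 1) + (17 / 100)\<^sup>2 * (\<epsilon> / (17 / 100)) = 34 / 100 * \<epsilon> - \<epsilon>\<^sup>2"
      using False by (simp add: power2_eq_square field_simps)
    then show ?thesis using True False e \<eta>
      by (intro that[of "\<epsilon> / (17 / 100)"]) (auto simp: forbidden_cost_def)
  next
    case False
    then show ?thesis using \<eta> by (intro that[of 1]) (auto simp: forbidden_cost_def)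
  qed
qed

text \<open>The slopes bound \<open>b + y\<close>: it is at most twice \<open>673 / 1000\<close> if
  \<open>y \<le> b\<close>, and at least \<open>673 / 1000\<close> otherwise.\<close>

lemma forbidden_potential_leaf:
  assumes b: "673 / 2000 \<le> b" "b \<le> 673 / 1000" and y: "0 \<le> y" "y \<le> 1"
  shows "b\<^sup>2 - y\<^sup>2 \<le> forbidden_potential (b - y)"
proof -
  have e: "b\<^sup>2 - y\<^sup>2 = (b + y) * (b - y)" by (simp add: power2_eq_square algebra_simps)
  show ?thesis
  proof (cases "y \<le> b")
    case True
    then have "(b + y) * (b - y) \<le> 1346 / 1000 * (b - y)" using b by (intro mult_right_mono) auto
    then show ?thesis using True e unfolding forbidden_potential_def by simp
  next
    case False
    then have "(b + y) * (b - y) \<le> 65 / 100 * (b - y)" using b by (intro mult_right_mono_neg) auto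
    then show ?thesis using False e unfolding forbidden_potential_def by simp
  qed
qed

text \<open>Let \<epsilon> be the size of the part of \<open>B\<close> that is neither forbidden nor
  in the separator; the potential is then compared at \<beta> - \<epsilon> and \<beta>. If
  \<epsilon> exceeds \<beta>, then \<open>X\<close> covers at least \<epsilon> - \<beta> of the
  separator, and the term \<open>2 * x * z\<close> reduces \<open>2 * x * \<epsilon>\<close> to
  \<open>2 * x * \<beta>\<close>.\<close>

lemma forbidden_potential_step:
  fixes b1 b2 x y z :: real
  assumes b: "0 \<le> b2" "b2 \<le> b1" "b1 + b2 \<le> 6 / 5" and beta: "b1 + b2 - y \<le> 1 / 5"
    and x: "0 \<le> x" "x \<le> b2" "x \<le> 1 / 2" and z: "0 \<le> z" "y - x - b1 \<le> z"
  shows "forbidden_potential (b1 - (y - x)) + (b2\<^sup>2 - x\<^sup>2 - 2 * x * z + forbidden_cost (b2 - x))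
    \<le> forbidden_potential (b1 + b2 - y)"
proof -
  define \<epsilon> where "\<epsilon> = b2 - x"
  define \<beta> where "\<beta> = b1 + b2 - y"
  have e: "0 \<le> \<epsilon>" "x \<le> 3 / 5 - \<epsilon>" "\<epsilon> \<le> 3 / 5" using b x by (auto simp: \<epsilon>_def)
  have \<beta>: "\<beta> \<le> 1 / 5" using beta by (simp add: \<beta>_def)
  have z': "\<epsilon> - \<beta> \<le> z" using z unfolding \<epsilon>_def \<beta>_def by simp
  have sq: "b2\<^sup>2 - x\<^sup>2 = 2 * (x * \<epsilon>) + \<epsilon>\<^sup>2" unfolding \<epsilon>_def by (simp add: power2_eq_square algebra_simps)
  have b1: "b1 - (y - x) = \<beta> - \<epsilon>" unfolding \<epsilon>_def \<beta>_def by simp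
  have xz: "0 \<le> x * z" "x * (\<epsilon> - \<beta>) \<le> x * z" using x z z' by (auto intro: mult_left_mono)
  have c17: "(17 / 100)\<^sup>2 = (289 / 10000 :: real)" by (simp add: power_divide)
  have cost: "\<epsilon>\<^sup>2 + forbidden_cost \<epsilon> = 34 / 100 * \<epsilon> \<and> \<epsilon> \<le> 17 / 100 \<or>
      \<epsilon>\<^sup>2 + forbidden_cost \<epsilon> = \<epsilon>\<^sup>2 + 289 / 10000 \<and> 17 / 100 \<le> \<epsilon>"
    unfolding forbidden_cost_def c17 by auto
  have quad: "\<epsilon>\<^sup>2 \<le> (l + u) * \<epsilon> - l * u" if "l \<le> \<epsilon>" "\<epsilon> \<le> u" for l u
  proof -
    have "0 \<le> (\<epsilon> - l) * (u - \<epsilon>)" using that by (intro mult_nonneg_nonneg) auto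
    then show ?thesis by (simp add: power2_eq_square algebra_simps)
  qed
  have "forbidden_potential (\<beta> - \<epsilon>) + (2 * (x * \<epsilon>) + \<epsilon>\<^sup>2 - 2 * (x * z) + forbidden_cost \<epsilon>) \<le> forbidden_potential \<beta>"
  proof (cases "\<epsilon> \<le> \<beta>")
    case True
    have "2 * (x * \<epsilon>) + (\<epsilon>\<^sup>2 + forbidden_cost \<epsilon>) \<le> 1346 / 1000 * \<epsilon>"
      using cost
    proof (elim disjE conjE)
      assume c: "\<epsilon>\<^sup>2 + forbidden_cost \<epsilon> = 34 / 100 * \<epsilon>"
      have "x * \<epsilon> \<le> 1 / 2 * \<epsilon>" using x e by (intro mult_right_mono) auto
      with c e show ?thesis by linarith
    next
      assume c: "\<epsilon>\<^sup>2 + forbidden_cost \<epsilon> = \<epsilon>\<^sup>2 + 289 / 10000" "17 / 100 \<le> \<epsilon>"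
      have "x * \<epsilon> \<le> 43 / 100 * \<epsilon>" using c e by (intro mult_right_mono) auto
      moreover have "\<epsilon>\<^sup>2 \<le> 37 / 100 * \<epsilon> - 34 / 1000"
        using quad[of "17 / 100" "1 / 5"] c True \<beta> by simp
      ultimately show ?thesis using c by linarith
    qed
    moreover have "forbidden_potential (\<beta> - \<epsilon>) = 1346 / 1000 * \<beta> - 1346 / 1000 * \<epsilon>"
      using True unfolding forbidden_potential_def by (simp add: field_simps)
    moreover have "forbidden_potential \<beta> = 1346 / 1000 * \<beta>" using True e unfolding forbidden_potential_def by simp
    ultimately show ?thesis using xz by linarith
  next
    case False
    have g: "forbidden_potential (\<beta> - \<epsilon>) = 65 / 100 * \<beta> - 65 / 100 * \<epsilon>"
      using False unfolding forbidden_potential_def by (simp add: field_simps)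
    have xe: "x * (\<epsilon> - \<beta>) = x * \<epsilon> - x * \<beta>" by (simp add: algebra_simps)
    have slope: "\<epsilon>\<^sup>2 + forbidden_cost \<epsilon> \<le> 65 / 100 * \<epsilon>"
      using cost
    proof (elim disjE conjE)
      assume "\<epsilon>\<^sup>2 + forbidden_cost \<epsilon> = \<epsilon>\<^sup>2 + 289 / 10000" "17 / 100 \<le> \<epsilon>"
      then show ?thesis using quad[of "5 / 100" "3 / 5"] e by simp
    qed (use e in linarith)
    show ?thesis
    proof (cases "0 \<le> \<beta>")
      case True
      have "65 / 100 * \<beta> - 65 / 100 * \<epsilon> + (\<epsilon>\<^sup>2 + forbidden_cost \<epsilon>) + 2 * (x * \<beta>) \<le> 1346 / 1000 * \<beta>"
        using cost
      proof (elim disjE conjE)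
        assume c: "\<epsilon>\<^sup>2 + forbidden_cost \<epsilon> = 34 / 100 * \<epsilon>"
        have "x * \<beta> \<le> 1 / 2 * \<beta>" using x True by (intro mult_right_mono) auto
        with c False True show ?thesis by linarith
      next
        assume c: "\<epsilon>\<^sup>2 + forbidden_cost \<epsilon> = \<epsilon>\<^sup>2 + 289 / 10000" "17 / 100 \<le> \<epsilon>"
        show ?thesis
        \<comment> \<open>Twice \<open>348 / 1000\<close> is the difference of the slopes
          \<open>1346 / 1000\<close> and \<open>65 / 100\<close>; from \<open>252 / 1000\<close> on,
          \<open>x \<le> 3 / 5 - \<epsilon>\<close> is at most \<open>348 / 1000\<close>.\<close>
        proof (cases "252 / 1000 \<le> \<epsilon>")
          case True
          have "x * \<beta> \<le> 348 / 1000 * \<beta>" using True e \<open>0 \<le> \<beta>\<close> by (intro mult_right_mono) auto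
          with slope \<open>0 \<le> \<beta>\<close> show ?thesis by linarith
        next
          case False
          have "x * \<beta> \<le> 43 / 100 * \<beta>" using c e True by (intro mult_right_mono) auto
          moreover have "\<epsilon>\<^sup>2 \<le> 422 / 1000 * \<epsilon> - 4284 / 100000"
            using quad[of "17 / 100" "252 / 1000"] c False by simp
          ultimately show ?thesis using c \<beta> by linarith
        qed
      qed
      moreover have "forbidden_potential \<beta> = 1346 / 1000 * \<beta>" using True unfolding forbidden_potential_def by simp
      ultimately show ?thesis using g xe xz by linarith
    next
      case neg: False
      then have "forbidden_potential \<beta> = 65 / 100 * \<beta>" unfolding forbidden_potential_def by simp
      moreover have "x * \<beta> \<le> 0" using x neg by (intro mult_nonneg_nonpos) auto
      ultimately show ?thesis using g xe xz slope by linarith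
    qed
  qed
  then show ?thesis unfolding b1 \<beta>_def[symmetric] \<epsilon>_def[symmetric] using sq by simp
qed

text \<open>For \<open>x\<close> above \<open>1 / 2\<close> the slope
  \<open>2 * x + 34 / 100\<close> of the previous argument can exceed \<open>1346 / 1000\<close>.
  Counting \<open>A\<close> as a complete graph at once works, because \<open>2 * x \<ge> y\<close>
  forces \<open>2 * \<epsilon> \<le> \<beta>\<close>.\<close>

lemma forbidden_potential_two_leaves:
  fixes b1 b2 x y z :: real
  assumes b: "b2 \<le> b1" "b1 + b2 \<le> 6 / 5" and beta: "b1 + b2 - y \<le> 1 / 5"
    and x: "1 / 2 \<le> x" "x \<le> b2" and y: "y \<le> 1" and z: "0 \<le> z"
  shows "b1\<^sup>2 - (y - x)\<^sup>2 + (b2\<^sup>2 - x\<^sup>2 - 2 * x * z + forbidden_cost (b2 - x))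
    \<le> forbidden_potential (b1 + b2 - y)"
proof -
  define \<epsilon> where "\<epsilon> = b2 - x"
  define \<beta> where "\<beta> = b1 + b2 - y"
  have e: "0 \<le> \<epsilon>" "\<epsilon> \<le> 1 / 10" "2 * \<epsilon> \<le> \<beta>" "\<beta> \<le> 1 / 5"
    using b x y beta by (auto simp: \<epsilon>_def \<beta>_def)
  have "b1\<^sup>2 - (y - x)\<^sup>2 = (\<beta> - \<epsilon>) * (b1 + (y - x))"
    unfolding \<epsilon>_def \<beta>_def by (simp add: power2_eq_square algebra_simps)
  also have "\<dots> \<le> (\<beta> - \<epsilon>) * (1 + \<beta> - \<epsilon>)"
    using e x y by (intro mult_left_mono) (auto simp: \<epsilon>_def \<beta>_def)
  also have "\<dots> = \<beta> - \<epsilon> + \<beta>\<^sup>2 - 2 * (\<epsilon> * \<beta>) + \<epsilon>\<^sup>2" by (simp add: power2_eq_square algebra_simps)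
  finally have 1: "b1\<^sup>2 - (y - x)\<^sup>2 \<le> \<beta> - \<epsilon> + \<beta>\<^sup>2 - 2 * (\<epsilon> * \<beta>) + \<epsilon>\<^sup>2" .
  have "x * \<epsilon> \<le> (3 / 5 - \<epsilon>) * \<epsilon>" using b x e by (intro mult_right_mono) (auto simp: \<epsilon>_def)
  then have "b2\<^sup>2 - x\<^sup>2 \<le> 6 / 5 * \<epsilon> - \<epsilon>\<^sup>2"
    unfolding \<epsilon>_def by (simp add: power2_eq_square field_simps)
  moreover have "forbidden_cost \<epsilon> = 34 / 100 * \<epsilon> - \<epsilon>\<^sup>2" using e unfolding forbidden_cost_def by simp
  moreover have "0 \<le> \<epsilon>\<^sup>2" "0 \<le> \<epsilon> * \<beta>" "0 \<le> x * z" using e x z by auto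
  moreover have "\<beta>\<^sup>2 \<le> 1 / 5 * \<beta>" using e by (intro square_le_mult) auto
  moreover have "forbidden_potential \<beta> = 1346 / 1000 * \<beta>" using e unfolding forbidden_potential_def by simp
  moreover have "27 / 100 * \<beta> - \<beta>\<^sup>2 \<ge> 54 / 100 * \<epsilon> - 2 * (\<epsilon> * \<beta>)"
  proof -
    have "0 \<le> (\<beta> - 2 * \<epsilon>) * (27 / 100 - \<beta>)" using e by (intro mult_nonneg_nonneg) auto
    then show ?thesis by (simp add: power2_eq_square field_simps)
  qed
  ultimately have "b1\<^sup>2 - (y - x)\<^sup>2 + (b2\<^sup>2 - x\<^sup>2 - 2 * (x * z) + forbidden_cost \<epsilon>) \<le> forbidden_potential \<beta>"
    using 1 e by linarith
  then show ?thesis unfolding \<epsilon>_def \<beta>_def by simp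
qed

context separable_arcs
begin

text \<open>By inclusion and exclusion the pairs forbidden in \<open>B\<close> have normalised
  number \<open>1 + (x + z)\<^sup>2 - z\<^sup>2\<close>.\<close>

lemma forbidden_attach:
  assumes sp: "splits W A B" and X: "X \<subseteq> W"
    and A: "arc_bound k E A (X \<inter> A) ((X \<inter> A) \<times> (X \<inter> A)) r c"
    and rs: "0 < r" "0 < s" "s \<le> 1"
    and x: "x = real (card (X \<inter> (B - A))) / real k" and z: "z = real (card (X \<inter> (A \<inter> B))) / real k"
  shows "arc_bound k E W X (X \<times> X) (r + s)
    (c + (ex B)\<^sup>2 - x\<^sup>2 - 2 * x * z + (ex B - x)\<^sup>2 * (1 / s - 1))"
proof -
  have W: "W = A \<union> B" and Y: "card (A \<inter> B) = k"
    and E: "E \<inter> W \<times> W \<subseteq> A \<times> A \<union> B \<times> B" using sp unfolding splits_def by auto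
  note fin = splits_finite[OF sp]
  define XB where "XB = A \<inter> B \<union> X \<inter> B"
  define NB where "NB = (A \<inter> B) \<times> (A \<inter> B) \<union> (X \<inter> B) \<times> (X \<inter> B)"
  have fX: "finite X" using X fin by (auto intro: finite_subset)
  have "card XB = k + card (X \<inter> (B - A))"
  proof -
    have "XB = (A \<inter> B) \<union> X \<inter> (B - A)" unfolding XB_def by blast
    moreover have "card ((A \<inter> B) \<union> X \<inter> (B - A)) = card (A \<inter> B) + card (X \<inter> (B - A))"
      using fin fX by (intro card_Un_disjoint) auto
    ultimately show ?thesis using Y by simp
  qed
  then have XB: "(real (card B) - real (card XB)) / real k = ex B - x"
    using k_pos unfolding x excess_def by (simp add: diff_divide_distrib add_divide_distrib)
  have "card (X \<inter> B) = card (X \<inter> (A \<inter> B)) + card (X \<inter> (B - A))"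
  proof -
    have "X \<inter> B = X \<inter> (A \<inter> B) \<union> X \<inter> (B - A)" by blast
    moreover have "card (X \<inter> (A \<inter> B) \<union> X \<inter> (B - A)) = card (X \<inter> (A \<inter> B)) + card (X \<inter> (B - A))"
      using fX by (intro card_Un_disjoint) auto
    ultimately show ?thesis by simp
  qed
  then have xz: "real (card (X \<inter> B)) / real k = z + x" unfolding x z by (simp add: add_divide_distrib)
  have "card NB + card (X \<inter> (A \<inter> B)) * card (X \<inter> (A \<inter> B)) = k * k + card (X \<inter> B) * card (X \<inter> B)"
  proof -
    have "card ((A \<inter> B) \<times> (A \<inter> B)) + card ((X \<inter> B) \<times> (X \<inter> B)) =
        card NB + card ((A \<inter> B) \<times> (A \<inter> B) \<inter> (X \<inter> B) \<times> (X \<inter> B))"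
      unfolding NB_def using fin fX by (intro card_Un_Int) auto
    moreover have "(A \<inter> B) \<times> (A \<inter> B) \<inter> (X \<inter> B) \<times> (X \<inter> B) = (X \<inter> (A \<inter> B)) \<times> (X \<inter> (A \<inter> B))"
      by blast
    ultimately show ?thesis by (simp add: card_cartesian_product Y)
  qed
  then have "real (card NB) + real (card (X \<inter> (A \<inter> B))) * real (card (X \<inter> (A \<inter> B)))
      = real k * real k + real (card (X \<inter> B)) * real (card (X \<inter> B))"
    by (metis of_nat_add of_nat_mult)
  then have "(real (card NB) + real (card (X \<inter> (A \<inter> B))) * real (card (X \<inter> (A \<inter> B)))) / (real k)\<^sup>2
      = (real k * real k + real (card (X \<inter> B)) * real (card (X \<inter> B))) / (real k)\<^sup>2" by simp
  then have "real (card NB) / (real k)\<^sup>2 + z\<^sup>2 = 1 + (real (card (X \<inter> B)) / real k)\<^sup>2"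
    using k_pos unfolding z by (simp add: add_divide_distrib power2_eq_square)
  then have NB: "real (card NB) / (real k)\<^sup>2 = 1 + x\<^sup>2 + 2 * x * z"
    unfolding xz by (simp add: power2_eq_square algebra_simps)
  have "arc_bound k E B XB NB s (1 + (ex B)\<^sup>2 - real (card NB) / (real k)\<^sup>2
       + ((real (card B) - real (card XB)) / real k)\<^sup>2 * (1 / s - 1))"
    using k_pos fin rs unfolding XB_def NB_def by (intro arc_bound_leaf) auto
  then have B: "arc_bound k E B XB NB s ((ex B)\<^sup>2 - x\<^sup>2 - 2 * x * z + (ex B - x)\<^sup>2 * (1 / s - 1))"
    unfolding NB XB by (simp add: algebra_simps)
  have "X \<times> X \<inter> A \<times> A = (X \<inter> A) \<times> (X \<inter> A)" "X \<times> X \<inter> B \<times> B = (X \<inter> B) \<times> (X \<inter> B)" by auto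
  then have "arc_bound k E (A \<union> B) X (X \<times> X) (r + s)
      (c + ((ex B)\<^sup>2 - x\<^sup>2 - 2 * x * z + (ex B - x)\<^sup>2 * (1 / s - 1)))"
    using A B E k_pos fin Y rs unfolding XB_def NB_def W by (intro arc_bound_Un) auto
  then show ?thesis unfolding W by (simp add: algebra_simps)
qed

lemma forbidden_leaf:
  assumes "W \<subseteq> V" "X \<subseteq> W"
  shows "arc_bound k E W X (X \<times> X) 1 (1 + (ex W)\<^sup>2 - (real (card X) / real k)\<^sup>2)"
  using arc_bound_leaf[of k W X "X \<times> X" 1 E] assms k_pos finite_subset[OF assms(1) finite_V]
  by (simp add: card_cartesian_product power_divide power2_eq_square)

lemma forbidden_bound:
  assumes \<sigma>: "\<sigma> \<le> 673 / 1000"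
  shows "W \<subseteq> V \<Longrightarrow> X \<subseteq> W \<Longrightarrow> y = real (card X) / real k \<Longrightarrow> y \<le> 1 \<Longrightarrow> 673 / 2000 \<le> ex W \<Longrightarrow>
    ex W \<le> 6 / 5 \<Longrightarrow> ex W - y \<le> 1 / 5 \<Longrightarrow> 0 < \<eta> \<Longrightarrow>
    \<exists>r c. arc_bound k E W X (X \<times> X) r c \<and> 1 \<le> r \<and>
      c + (17 / 100)\<^sup>2 * r \<le> 1 + (17 / 100)\<^sup>2 + forbidden_potential (ex W - y) + \<eta>"
proof (induction "card W" arbitrary: W X y \<eta> rule: less_induct)
  case less
  have y0: "0 \<le> y" using less.prems by simp
  show ?case
  proof (cases "ex W \<le> 673 / 1000")
    case True
    then have "(ex W)\<^sup>2 - y\<^sup>2 \<le> forbidden_potential (ex W - y)"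
      using less.prems y0 by (intro forbidden_potential_leaf) auto
    then show ?thesis using forbidden_leaf[OF less.prems(1,2)] less.prems(3,8)
      by (intro exI[of _ 1] exI[of _ "1 + (ex W)\<^sup>2 - y\<^sup>2"]) auto
  next
    case False
    then have "\<sigma> < ex W" using \<sigma> by simp
    then obtain A B where sp: "splits W A B" and AB: "ex B \<le> ex A"
      by (rule splits_exists[OF less.prems(1)])
    note fin = splits_finite[OF sp] and sz = splits_excess[OF sp]
    have W: "W = A \<union> B" and Y: "card (A \<inter> B) = k" using sp unfolding splits_def by auto
    have fX: "finite X" using less.prems(2) fin by (auto intro: finite_subset)
    define x where "x = real (card (X \<inter> (B - A))) / real k"
    define z where "z = real (card (X \<inter> (A \<inter> B))) / real k"
    have "card X = card (X \<inter> A) + card (X \<inter> (B - A))"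
    proof -
      have "X = X \<inter> A \<union> X \<inter> (B - A)" using less.prems(2) W by blast
      moreover have "card (X \<inter> A \<union> X \<inter> (B - A)) = card (X \<inter> A) + card (X \<inter> (B - A))"
        using fX by (intro card_Un_disjoint) auto
      ultimately show ?thesis by simp
    qed
    then have y: "real (card (X \<inter> A)) / real k = y - x"
      using less.prems(3) unfolding x_def by (simp add: add_divide_distrib)
    have diff: "real (card (S - T)) / real k = ex S" if "finite S" "card (S \<inter> T) = k" for S T
    proof -
      have "card S = card (S \<inter> T) + card (S - T)"
        using that(1) by (subst card_Un_disjoint[symmetric]) (auto simp: Int_Diff_Un)
      then show ?thesis using that(2) k_pos unfolding excess_def by (simp add: add_divide_distrib)
    qed
    have "x \<le> real (card (B - A)) / real k"
      unfolding x_def using fin by (intro divide_right_mono) (auto intro!: card_mono)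
    also have "\<dots> = ex B" using diff[OF fin(3), of A] Y by (simp add: Int_commute)
    finally have x: "0 \<le> x" "x \<le> ex B" by (auto simp: x_def)
    have z: "0 \<le> z" "y - x - ex A \<le> z"
    proof -
      have "card (X \<inter> A) \<le> card (X \<inter> (A \<inter> B)) + card (A - B)"
      proof -
        have "card (X \<inter> A) \<le> card (X \<inter> (A \<inter> B) \<union> (A - B))" using fX fin by (intro card_mono) auto
        also have "\<dots> \<le> card (X \<inter> (A \<inter> B)) + card (A - B)" by (rule card_Un_le)
        finally show ?thesis .
      qed
      then have "real (card (X \<inter> A)) \<le> real (card (X \<inter> (A \<inter> B))) + real (card (A - B))"
        by (metis of_nat_add of_nat_le_iff)
      then have "real (card (X \<inter> A)) / real k \<le> (real (card (X \<inter> (A \<inter> B))) + real (card (A - B))) / real k"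
        by (intro divide_right_mono) auto
      also have "\<dots> = z + ex A" using diff[OF fin(2), of B] Y by (simp add: z_def add_divide_distrib)
      finally show "y - x - ex A \<le> z" using y by simp
    qed (simp add: z_def)
    \<comment> \<open>Half of the slack \<eta> goes to the recursive bound and half to the weight of
      \<open>B\<close>.\<close>
    have sum: "ex A + ex B - y \<le> 1 / 5" "ex A + ex B \<le> 6 / 5" using less.prems sz(1) by auto
    have "\<exists>r c. arc_bound k E A (X \<inter> A) ((X \<inter> A) \<times> (X \<inter> A)) r c \<and> 1 \<le> r \<and>
        c + (17 / 100)\<^sup>2 * r + ((ex B)\<^sup>2 - x\<^sup>2 - 2 * x * z + forbidden_cost (ex B - x))
          \<le> 1 + (17 / 100)\<^sup>2 + forbidden_potential (ex W - y) + \<eta> / 2"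
    proof (cases "x \<le> 1 / 2")
      case True
      have "\<exists>r c. arc_bound k E A (X \<inter> A) ((X \<inter> A) \<times> (X \<inter> A)) r c \<and> 1 \<le> r \<and>
        c + (17 / 100)\<^sup>2 * r \<le> 1 + (17 / 100)\<^sup>2 + forbidden_potential (ex A - (y - x)) + \<eta> / 2"
      proof (rule less.hyps[OF sz(4) fin(4)])
        show "y - x = real (card (X \<inter> A)) / real k" by (simp add: y)
      qed (use less.prems sz AB False x in auto)
      moreover have "forbidden_potential (ex A - (y - x)) + ((ex B)\<^sup>2 - x\<^sup>2 - 2 * x * z + forbidden_cost (ex B - x))
          \<le> forbidden_potential (ex W - y)"
        unfolding sz(1) using forbidden_potential_step[OF _ AB sum(2,1) x True z] sz by simp
      ultimately show ?thesis by fastforce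
    next
      case False
      have "(ex A)\<^sup>2 - (y - x)\<^sup>2 + ((ex B)\<^sup>2 - x\<^sup>2 - 2 * x * z + forbidden_cost (ex B - x))
          \<le> forbidden_potential (ex W - y)"
        unfolding sz(1) using forbidden_potential_two_leaves[OF AB sum(2,1) _ x(2) less.prems(4) z(1)] False by simp
      moreover have "arc_bound k E A (X \<inter> A) ((X \<inter> A) \<times> (X \<inter> A)) 1 (1 + (ex A)\<^sup>2 - (y - x)\<^sup>2)"
        using forbidden_leaf[OF fin(4), of "X \<inter> A"] y by simp
      ultimately show ?thesis using less.prems(8)
        by (intro exI[of _ 1] exI[of _ "1 + (ex A)\<^sup>2 - (y - x)\<^sup>2"]) auto
    qed
    then obtain r c where A: "arc_bound k E A (X \<inter> A) ((X \<inter> A) \<times> (X \<inter> A)) r c" "1 \<le> r"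
        "c + (17 / 100)\<^sup>2 * r + ((ex B)\<^sup>2 - x\<^sup>2 - 2 * x * z + forbidden_cost (ex B - x))
          \<le> 1 + (17 / 100)\<^sup>2 + forbidden_potential (ex W - y) + \<eta> / 2" by blast
    obtain s where s: "0 < s" "s \<le> 1"
        "(ex B - x)\<^sup>2 * (1 / s - 1) + (17 / 100)\<^sup>2 * s \<le> forbidden_cost (ex B - x) + \<eta> / 2"
      using forbidden_cost_attained[of "ex B - x" "\<eta> / 2"] x less.prems(8) by auto
    have "arc_bound k E W X (X \<times> X) (r + s)
        (c + (ex B)\<^sup>2 - x\<^sup>2 - 2 * x * z + (ex B - x)\<^sup>2 * (1 / s - 1))"
      using A s by (intro forbidden_attach[OF sp less.prems(2) _ _ _ _ x_def z_def]) auto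
    moreover have "c + (ex B)\<^sup>2 - x\<^sup>2 - 2 * x * z + (ex B - x)\<^sup>2 * (1 / s - 1) + (17 / 100)\<^sup>2 * (r + s)
        \<le> 1 + (17 / 100)\<^sup>2 + forbidden_potential (ex W - y) + \<eta>"
      using A(3) s(3) unfolding distrib_left by linarith
    ultimately show ?thesis using A(2) s(1)
      by (intro exI[of _ "r + s"] exI conjI) auto
  qed
qed

text \<open>The tangent of \<open>2 / (3 r)\<close> at \<open>r = a\<close> turns a bound on \<open>c + l r\<close> into one on \<open>c\<close>.\<close>

lemma good_from_slope:
  assumes W: "bounded W r c" "0 < r" and c: "c + l * r \<le> D * ex W + t"
    and a: "0 < a" "t \<le> 4 / (3 * a)" "2 / (3 * a\<^sup>2) \<le> l" and r: "t - l * r \<le> 2 / 9"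
  shows "\<exists>r\<ge>3. good D W r"
proof (cases "3 \<le> r")
  case True
  have "4 / (3 * a) - 2 * r / (3 * a\<^sup>2) \<le> 2 / (3 * r)" using W a by (intro reciprocal_tangent) auto
  moreover have "2 / (3 * a\<^sup>2) * r \<le> l * r" using a W by (intro mult_right_mono) auto
  ultimately have "good D W r" using W c a by (intro goodI[of W r c]) auto
  then show ?thesis using True by blast
next
  case False
  then have "good D W 3" using W c r by (intro goodI[of W r c]) auto
  then show ?thesis by blast
qed

section \<open>The case of separability 1 / 5\<close>

lemma large_piece:
  assumes \<sigma>: "\<sigma> \<le> 673 / 1000" and sp: "splits W A B" and B: "1 < ex B" "ex B < 6 / 5"
  obtains s d where "arc_bound k E B (A \<inter> B) ((A \<inter> B) \<times> (A \<inter> B)) s d" "1 \<le> s"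
    "d + 289 / 10000 * s \<le> 10294 / 10000 + 1346 / 1000 * (ex B - 1)"
proof -
  have Y: "card (A \<inter> B) = k" using sp unfolding splits_def by simp
  have "\<exists>s d. arc_bound k E B (A \<inter> B) ((A \<inter> B) \<times> (A \<inter> B)) s d \<and> 1 \<le> s \<and>
      d + (17 / 100)\<^sup>2 * s \<le> 1 + (17 / 100)\<^sup>2 + forbidden_potential (ex B - 1) + 5 / 10000"
    using B Y k_pos splits_finite[OF sp] by (intro forbidden_bound[OF \<sigma>]) auto
  then show ?thesis using that B by (auto simp: forbidden_potential_def power_divide)
qed

lemma good_small_separability_base:
  assumes \<sigma>: "\<sigma> \<le> 24 / 100" and sp: "splits W A B" and g: "6 / 5 \<le> ex W" "ex B \<le> ex A" "ex A < 6 / 5"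
  shows "\<exists>r\<ge>3. good (1109 / 1000) W r"
proof -
  note sz = splits_excess[OF sp] and fin = splits_finite[OF sp]
  have WV: "W \<subseteq> V" using sp unfolding splits_def by blast
  have l2: "2 / 3 \<le> ln (2 :: real)" using ln_add_ge[of 1 1] by simp
  have l4: "4 / 3 \<le> ln (t / (7 / 25))" if "28 / 25 \<le> t" for t :: real
  proof -
    have "ln (2 ^ 2) \<le> ln (t / (7 / 25))" using that by (subst ln_le_cancel_iff) auto
    moreover have "ln (2 ^ 2 :: real) = 2 * ln 2" by (subst ln_realpow) auto
    ultimately show ?thesis using l2 by linarith
  qed
  \<comment> \<open>The factor \<open>4 / 3\<close> is \<open>T / \<mu>\<close> for
    \<open>T = 7 / 25\<close> and \<open>\<mu> = 21 / 100\<close>, the largest that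
    \<open>\<nu> * \<mu> \<le> T\<close> admits.\<close>
  have chain: "\<exists>r c. bounded U r c \<and> 1 + 4 / 3 * ln (ex U / (7 / 25)) \<le> r \<and>
      c + (21 / 100)\<^sup>2 * r \<le> potential (21 / 100) (11812 / 10000) (ex U)"
    if "U \<subseteq> V" "7 / 25 < ex U" for U
    using \<sigma> that ln_2_le leaf_bound_21 by (intro bounded_potential) auto
  have c21: "(21 / 100)\<^sup>2 = (441 / 10000 :: real)" by (simp add: power_divide)
  \<comment> \<open>At \<open>35 / 9\<close> the slope of \<open>2 / (3 * r)\<close> nearly equals
    the price. The bound \<open>2777 / 1000\<close> is just below
    \<open>1 + 4 / 3 * (4 / 3)\<close>, and there \<open>3428 / 10000 - 441 / 10000 * r\<close> is
    below \<open>2 / 9\<close>.\<close>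
  have fin21: "\<exists>r\<ge>3. good (1109 / 1000) W r"
    if "bounded W r c" "c + 441 / 10000 * r \<le> 1109 / 1000 * ex W + 3428 / 10000" "2777 / 1000 \<le> r" for r c
    using that by (intro good_from_slope[where a = "35 / 9" and l = "441 / 10000" and t = "3428 / 10000"])
      (auto simp: power_divide)
  consider "ex W \<le> 2" | "2 < ex W" "ex B \<le> 1" | "1 < ex B" by linarith
  then show ?thesis
  proof cases
    case 1
    obtain r c where rc: "bounded W r c" "1 + 4 / 3 * ln (ex W / (7 / 25)) \<le> r"
        "c + (21 / 100)\<^sup>2 * r \<le> potential (21 / 100) (11812 / 10000) (ex W)"
      using chain[OF WV] g by auto
    have "2777 / 1000 \<le> r" using rc(2) l4[of "ex W"] g by linarith
    then show ?thesis using rc potential_21_le[OF g(1) 1] c21 by (intro fin21[of r c]) auto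
  next
    case 2
    then have a: "1 \<le> ex A" "8 / 10 \<le> ex B" using g sz(1) by auto
    obtain r c where rc: "bounded A r c" "1 + 4 / 3 * ln (ex A / (7 / 25)) \<le> r"
        "c + (21 / 100)\<^sup>2 * r \<le> potential (21 / 100) (11812 / 10000) (ex A)"
      using chain[OF fin(4)] a by auto
    have r: "188 / 100 \<le> r"
    proof -
      have "ln 2 \<le> ln (ex A / (7 / 25))" using a by (subst ln_le_cancel_iff) auto
      then show ?thesis using rc(2) l2 by linarith
    qed
    have "(ex B - 1) * (ex B - 109 / 1000) \<le> 0" using a 2 by (intro mult_nonpos_nonneg) auto
    then have "(ex B)\<^sup>2 \<le> 1109 / 1000 * ex B - 109 / 1000" by (simp add: power2_eq_square field_simps)
    moreover have "bounded W (r + 1) (c + (ex B)\<^sup>2 / 1)" using rc r by (intro bounded_attach[OF sp]) auto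
    moreover have "potential (21 / 100) (11812 / 10000) (ex A) \<le> 1109 / 1000 * ex A + 4056 / 10000"
      using a g by (intro potential_21_le_near_1) auto
    ultimately have "c + (ex B)\<^sup>2 + 441 / 10000 * (r + 1) \<le> 1109 / 1000 * ex W + 3428 / 10000"
      using rc(3) unfolding sz(1) c21 distrib_left by linarith
    then show ?thesis using \<open>bounded W (r + 1) (c + (ex B)\<^sup>2 / 1)\<close> r
      by (intro fin21[of "r + 1" "c + (ex B)\<^sup>2"]) auto
  next
    case 3
    then have a: "1 \<le> ex A" using g by simp
    have "\<exists>r c. bounded A r c \<and> 1 + 0 * ln (ex A / (6 / 25)) \<le> r \<and>
        c + (17 / 100)\<^sup>2 * r \<le> potential (17 / 100) (1131 / 1000) (ex A)"
      using \<sigma> fin a leaf_bound_17 by (intro bounded_potential) auto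
    then obtain r c where rc: "bounded A r c" "1 \<le> r"
        "c + 289 / 10000 * r \<le> potential (17 / 100) (1131 / 1000) (ex A)"
      by (auto simp: power_divide)
    obtain s d where B: "arc_bound k E B (A \<inter> B) ((A \<inter> B) \<times> (A \<inter> B)) s d" "1 \<le> s"
        "d + 289 / 10000 * s \<le> 10294 / 10000 + 1346 / 1000 * (ex B - 1)"
      using large_piece[OF _ sp] \<sigma> 3 g by auto
    have "bounded W (r + s) (c + d)" using rc B by (intro bounded_merge[OF sp]) auto
    \<comment> \<open>The slope \<open>1346 / 1000\<close> on \<open>B\<close> exceeds the target,
      but \<open>777 / 1000\<close> on \<open>A\<close> falls short of it by more, and
      \<open>ex B \<le> ex A\<close>.\<close>
    moreover have "c + d + 289 / 10000 * (r + s) \<le> 1109 / 1000 * ex W + 2772 / 10000"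
      using rc(3) B(3) potential_17_le[of "ex A"] a g sz(1) 3 by (simp add: field_simps)
    moreover have "2772 / 10000 - 289 / 10000 * (r + s) \<le> 2 / 9"
      using rc(2) B(2) unfolding distrib_left by linarith
    ultimately show ?thesis using rc(2) B(2)
      by - (rule good_from_slope[where a = "481 / 100" and l = "289 / 10000" and t = "2772 / 10000"],
        assumption, simp_all add: power_divide)
  qed
qed

lemma good_small_separability_attach:
  assumes \<sigma>: "\<sigma> \<le> 24 / 100" and sp: "splits W A B" and B: "ex B < 6 / 5"
    and A: "good (1109 / 1000) A r" "3 \<le> r"
  shows "\<exists>r'\<ge>3. good (1109 / 1000) W r'"
proof -
  have b: "0 < ex B" using splits_excess[OF sp] by simp
  consider "ex B \<le> 6 / 100" | "6 / 100 < ex B" "ex B \<le> 1" | "1 < ex B" by linarith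
  then show ?thesis
  proof cases
    case 1
    let ?s = "4 * ex B"
    have "(ex B)\<^sup>2 / ?s = ex B / 4" using b by (simp add: power2_eq_square)
    moreover have "?s / (3 * (3 + ?s)) \<le> ?s / 9" using b by (intro divide_left_mono) auto
    ultimately have "(ex B)\<^sup>2 / ?s + 2 / 3 * (?s / (3 * (3 + ?s))) \<le> 1109 / 1000 * ex B"
      using b by linarith
    then have "good (1109 / 1000) W (r + ?s)"
      using b 1 A by (intro good_attach[OF sp, where \<rho> = 3]) auto
    then show ?thesis using A b by (intro exI[of _ "r + ?s"]) auto
  next
    case 2
    \<comment> \<open>The chord of the square between \<open>6 / 100\<close> and 1 has slope
      \<open>106 / 100\<close>; its constant \<open>6 / 100\<close> covers the loss
      \<open>1 / 18\<close>.\<close>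
    then have "(ex B - 6 / 100) * (ex B - 1) \<le> 0" by (intro mult_nonneg_nonpos) auto
    then have "(ex B)\<^sup>2 / 1 + 2 / 3 * (1 / (3 * (3 + 1))) \<le> 1109 / 1000 * ex B"
      using 2 by (simp add: power2_eq_square field_simps)
    then have "good (1109 / 1000) W (r + 1)"
      using A by (intro good_attach[OF sp, where \<rho> = 3]) auto
    then show ?thesis using A by (intro exI[of _ "r + 1"]) auto
  next
    case 3
    obtain s d where s: "arc_bound k E B (A \<inter> B) ((A \<inter> B) \<times> (A \<inter> B)) s d" "1 \<le> s"
        "d + 289 / 10000 * s \<le> 10294 / 10000 + 1346 / 1000 * (ex B - 1)"
      using large_piece[OF _ sp] \<sigma> 3 B by auto
    define R where "R = 2 / (3 * (3 + s))"
    have "2 / (3 * r) - 2 / (3 * (r + s)) \<le> 2 / 9 - R"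
    proof -
      have "2 / (3 * r) - 2 / (3 * (r + s)) = 2 / 3 * (s / (r * (r + s)))"
        using A s by (simp add: divide_simps)
      also have "\<dots> \<le> 2 / 3 * (s / (3 * (3 + s)))"
        using A s by (intro mult_left_mono divide_left_mono mult_mono) auto
      also have "\<dots> = 2 / 9 - R"
        unfolding R_def using s by (simp add: divide_simps)
      finally show ?thesis .
    qed
    moreover have "4 / (3 * (481 / 100)) - 2 * (3 + s) / (3 * (481 / 100)\<^sup>2) \<le> R"
      unfolding R_def using s by (intro reciprocal_tangent) auto
    then have "2772 / 10000 - 289 / 10000 * 3 - 289 / 10000 * s \<le> R"
      using s by (simp add: power2_eq_square field_simps)
    \<comment> \<open>Nearly sharp as \<open>ex B\<close> approaches \<open>6 / 5\<close>, which
      limits the slope \<open>1346 / 1000\<close>.\<close>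
    ultimately have "d + 2 / (3 * r) \<le> 1109 / 1000 * ex B + 2 / (3 * (r + s))"
      using s(3) B by (simp add: field_simps)
    then have "1109 / 1000 * ex A + 2 / (3 * r) + d \<le> 1109 / 1000 * ex W + 2 / (3 * (r + s))"
      unfolding splits_excess(1)[OF sp] distrib_left[of "1109 / 1000"] by linarith
    moreover have "bounded W (r + s) (1109 / 1000 * ex A + 2 / (3 * r) + d)"
      using A s unfolding good_def by (intro bounded_merge[OF sp]) auto
    ultimately have "good (1109 / 1000) W (r + s)"
      using A s by (intro goodI) auto
    then show ?thesis using A s by (intro exI[of _ "r + s"]) auto
  qed
qed

lemma good_small_separability:
  assumes "\<sigma> \<le> 24 / 100" "W \<subseteq> V" "6 / 5 \<le> ex W"
  shows "\<exists>r\<ge>3. good (1109 / 1000) W r"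
proof (rule good_induct[where \<gamma> = "6 / 5"])
qed (use assms good_small_separability_base good_small_separability_attach in auto)

end

section \<open>Assembly of the three alternatives\<close>

theorem theorem5:
  fixes k :: nat and \<sigma> \<gamma> \<rho> \<delta> g :: real and G :: "'a pair_pre_digraph"
  assumes k_pos: "k > 0"
    and params:
      "(\<sigma> \<ge> (sqrt 2 + 1) / sqrt 3 \<and> \<gamma> = 1 / (3 * \<sigma>) \<and> \<rho> = 1 \<and> \<delta> = 2 + \<sigma> + 1 / (3 * \<sigma>)) \<or>
       (\<sigma> = 1 / 3 * sqrt (5 / 2) \<and> \<gamma> = sqrt 10 / 3 \<and> \<rho> = 2 \<and> \<delta> = 2 + 11 / 3 * sqrt (1 / 10)) \<or>
       (\<sigma> = 0.2 \<and> \<gamma> = 1.2 \<and> \<rho> = 3 \<and> \<delta> = 3.109)"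
    and graph: "pair_fin_digraph G"
    and sep: "separable k \<sigma> G"
    and g_def: "g = nverts k G - 1"
    and g_ge: "g \<ge> \<gamma>"
  shows "\<exists>r::real. r \<ge> \<rho> \<and>
    (\<forall>(G' :: 'a pair_pre_digraph) (l::nat) (A :: nat \<Rightarrow> 'a pair_pre_digraph).
       spanning (with_proj G') (with_proj G) \<and>
       (\<forall>i\<in>{1..l}. anticlique (A i) G') \<and>
       disjoint_family_on (\<lambda>i. pverts (A i)) {1..l} \<longrightarrow>
       narcs k G' \<le> \<delta> * g + 1 / r * (2 / 3 - (\<Sum>i=1..l. (nverts k (A i))\<^sup>2)))"
proof -
  interpret separable_arcs k "pverts G" "parcs G" \<sigma>
    using k_pos graph sep by (rule separable_arcs_digraph)
  have g: "g = excess k (pverts G)" unfolding g_def nverts_def excess_def by simp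
  have "\<exists>r\<ge>\<rho>. good (\<delta> - 2) (pverts G) r"
    using params
  proof (elim disjE conjE)
    assume "\<sigma> \<ge> (sqrt 2 + 1) / sqrt 3" "\<gamma> = 1 / (3 * \<sigma>)" "\<rho> = 1" "\<delta> = 2 + \<sigma> + 1 / (3 * \<sigma>)"
    then show ?thesis using good_large_separability[of "pverts G"] g g_ge by simp
  next
    assume p: "\<sigma> = 1 / 3 * sqrt (5 / 2)" "\<gamma> = sqrt 10 / 3" "\<rho> = 2" "\<delta> = 2 + 11 / 3 * sqrt (1 / 10)"
    have "sqrt (5 / 2) = sqrt 10 / 2"
      using real_sqrt_divide[of 10 4] by simp
    then have "2 * \<sigma> = \<gamma>" using p by simp
    moreover have "\<sigma>\<^sup>2 = 5 / 18" "0 < \<sigma>" unfolding p(1) by (auto simp: power_mult_distrib power_divide)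
    moreover have "sqrt (1 / 10) = sqrt 10 / 10"
      using real_sqrt_divide[of 10 100] by simp
    then have "11 / 5 * \<sigma> = \<delta> - 2" using p \<open>sqrt (5 / 2) = sqrt 10 / 2\<close> by simp
    ultimately show ?thesis using good_middle_separability[of "pverts G"] g g_ge p by simp
  next
    assume p: "\<sigma> = 0.2" "\<gamma> = 1.2" "\<rho> = 3" "\<delta> = 3.109"
    then have \<delta>: "\<delta> - 2 = 1109 / 1000" by simp
    show ?thesis unfolding \<delta> using good_small_separability[of "pverts G"] g g_ge p(1-3) by simp
  qed
  then obtain r where r: "\<rho> \<le> r" "good (\<delta> - 2) (pverts G) r" by blast
  show ?thesis
  proof (intro exI[of _ r] conjI allI impI)
    fix G' :: "'a pair_pre_digraph" and l :: nat and A :: "nat \<Rightarrow> 'a pair_pre_digraph"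
    assume *: "spanning (with_proj G') (with_proj G) \<and> (\<forall>i\<in>{1..l}. anticlique (A i) G') \<and>
      disjoint_family_on (\<lambda>i. pverts (A i)) {1..l}"
    have "narcs k G' \<le> 2 * (nverts k G - 1) + ((\<delta> - 2) * g + 2 / (3 * r)) - (\<Sum>i=1..l. (nverts k (A i))\<^sup>2) / r"
      using arc_bound_anticliques[of k G r "(\<delta> - 2) * g + 2 / (3 * r)" G' l A] * r(2) g
      unfolding good_def by simp
    also have "\<dots> = \<delta> * g + 1 / r * (2 / 3 - (\<Sum>i=1..l. (nverts k (A i))\<^sup>2))"
      unfolding g_def by (simp add: algebra_simps diff_divide_distrib)
    finally show "narcs k G' \<le> \<delta> * g + 1 / r * (2 / 3 - (\<Sum>i=1..l. (nverts k (A i))\<^sup>2))" .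
  qed (rule r)
qed

end
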